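(* Let $\mathbf{a}=(a_i)_{i\in\mathbb{Z}}\in\mathbb{R}^{\mathbb{Z}}$ and $\mathbf{b}=(b_j)_{j\in\mathbb{Z}}\in\mathbb{R}^{\mathbb{Z}}$ satisfy $a_i+b_j>0$ for all $i,j\in\mathbb{Z}$, and let $\sigma$ and $\tau$ be finite permutations of $\mathbb{Z}$ (i.e. bijections of $\mathbb{Z}$ with $\sigma(i)=\tau(i)=i$ for all but finitely many $i$). Let $\mathcal{U}_{\sigma,\tau}$ be the set of all pairs $(\mathbf{x},\mathbf{y})$ with $\mathbf{x}=(x_1,x_2)\in\mathbb{Z}^2$, $\mathbf{y}=(y_1,y_2)\in\mathbb{Z}^2$, $x_1\le y_1$, $x_2\le y_2$, such that $$\sigma(\mathbb{Z}_{<x_1})=\mathbb{Z}_{<x_1},\quad \sigma(\mathbb{Z}_{>y_1})=\mathbb{Z}_{>y_1},\quad \tau(\mathbb{Z}_{<x_2})=\mathbb{Z}_{<x_2},\quad \tau(\mathbb{Z}_{>y_2})=\mathbb{Z}_{>y_2}.$$ Then, as equality of joint distributions, $$\{\mathrm{L}_{\mathbf{x},\mathbf{y}}[\omega^{\mathbf{a},\mathbf{b}}]:(\mathbf{x},\mathbf{y})\in\mathcal{U}_{\sigma,\tau}\}\ \stackrel{\mathrm{dist.}}{=}\ \{\mathrm{L}_{\mathbf{x},\mathbf{y}}[\omega^{\mathbf{a}_\sigma,\mathbf{b}_\tau}]:(\mathbf{x},\mathbf{y})\in\mathcal{U}_{\sigma,\tau}\},$$ where $\mathbf{a}_\sigma=(a_{\sigma(i)})_{i\in\mathbb{Z}}$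 and $\mathbf{b}_\tau=(b_{\tau(j)})_{j\in\mathbb{Z}}$.
   Context: A random variable $X$ is $\mathrm{Exp}\{a\}$, $a>0$, if $\mathbf{P}(X>t)=e^{-at}$ for $t\ge 0$. For sequences $\mathbf{a},\mathbf{b}\in\mathbb{R}^{\mathbb{Z}}$ with $a_i+b_j>0$ for all $i,j$, $\omega^{\mathbf{a},\mathbf{b}}=\{\omega^{\mathbf{a},\mathbf{b}}_{(i,j)}:i,j\in\mathbb{Z}\}$ denotes independent weights with $\omega^{\mathbf{a},\mathbf{b}}_{(i,j)}\sim\mathrm{Exp}\{a_i+b_j\}$. For $\mathbf{u}\le\mathbf{v}$ (coordinatewise) in $\mathbb{Z}^2$ and real weights $\mathrm{w}$ on $\mathbb{Z}^2$, the last-passage time is $\mathrm{L}_{\mathbf{u},\mathbf{v}}[\mathrm{w}]=\max_{\pi\in\Pi_{\mathbf{u},\mathbf{v}}}\sum_{\mathbf{p}\in\pi}\mathrm{w}_{\mathbf{p}}$, where $\Pi_{\mathbf{u},\mathbf{v}}$ is the set of up-right lattice paths (steps $(1,0)$ or $(0,1)$) from $\mathbf{u}$ to $\mathbf{v}$, each viewed as its set of vertices including both endpoints. *)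

theory Defs
  imports "HOL-Probability.Probability"
begin

text \<open>The lattice \<open>\<int>\<^sup>2\<close> is the type \<open>int \<times> int\<close>. A path is first given as the list of its successive
  vertices and then, as a member of \<open>up_right_paths\<close>, identified with its set of vertices.\<close>

definition up_right_step :: "int \<times> int \<Rightarrow> int \<times> int \<Rightarrow> bool" where
  "up_right_step p q \<longleftrightarrow> q = p + (1, 0) \<or> q = p + (0, 1)"

definition up_right_paths :: "int \<times> int \<Rightarrow> int \<times> int \<Rightarrow> (int \<times> int) set set" where
  "up_right_paths u v =
     {set ps | ps. ps \<noteq> [] \<and> hd ps = u \<and> last ps = v \<and> successively up_right_step ps}"

text \<open>Only meant for \<open>u \<le> v\<close> coordinatewise: otherwise there is no path, and the value is the
  unspecified \<open>Max {}\<close>.\<close>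

definition last_passage :: "int \<times> int \<Rightarrow> int \<times> int \<Rightarrow> (int \<times> int \<Rightarrow> real) \<Rightarrow> real" where
  "last_passage u v w = Max ((\<lambda>\<pi>. \<Sum>p\<in>\<pi>. w p) ` up_right_paths u v)"

definition exp_weights ::
    "'s measure \<Rightarrow> (int \<Rightarrow> real) \<Rightarrow> (int \<Rightarrow> real) \<Rightarrow> (int \<times> int \<Rightarrow> 's \<Rightarrow> real) \<Rightarrow> bool" where
  "exp_weights M a b \<omega> \<longleftrightarrow>
     prob_space M \<and>
     prob_space.indep_vars M (\<lambda>_. borel) \<omega> UNIV \<and>
     (\<forall>i j. distributed M lborel (\<omega> (i, j)) (exponential_density (a i + b j)))"

definition finite_perm :: "(int \<Rightarrow> int) \<Rightarrow> bool" where
  "finite_perm \<sigma> \<longleftrightarrow> bij \<sigma> \<and> finite {i. \<sigma> i \<noteq> i}"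

definition perm_pairs :: "(int \<Rightarrow> int) \<Rightarrow> (int \<Rightarrow> int) \<Rightarrow> ((int \<times> int) \<times> (int \<times> int)) set" where
  "perm_pairs \<sigma> \<tau> =
     {((x1, x2), (y1, y2)) | x1 x2 y1 y2. x1 \<le> y1 \<and> x2 \<le> y2 \<and>
        \<sigma> ` {..<x1} = {..<x1} \<and> \<sigma> ` {y1<..} = {y1<..} \<and>
        \<tau> ` {..<x2} = {..<x2} \<and> \<tau> ` {y2<..} = {y2<..}}"

text \<open>The law of a real process indexed by \<open>I\<close>, on the product \<open>\<sigma>\<close>-algebra of \<open>\<real>\<^sup>I\<close>. This is
  meaningful only if each \<open>X i\<close> with \<open>i \<in> I\<close> is measurable.\<close>

definition joint_law :: "'s measure \<Rightarrow> 'i set \<Rightarrow> ('i \<Rightarrow> 's \<Rightarrow> real) \<Rightarrow> ('i \<Rightarrow> real) measure" where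
  "joint_law M I X = distr M (\<Pi>\<^sub>M i\<in>I. borel) (\<lambda>s. \<lambda>i\<in>I. X i s)"

lemma up_right_list_bounds:
  assumes "successively up_right_step ps" "ps \<noteq> []"
  shows "set ps \<subseteq> {fst (hd ps)..fst (last ps)} \<times> {snd (hd ps)..snd (last ps)}"
  using assms
proof (induction ps)
  case Nil
  then show ?case by simp
next
  case (Cons p ps)
  show ?case
  proof (cases ps)
    case Nil
    then show ?thesis by (cases p) auto
  next
    case (Cons q qs)
    have IH: "set ps \<subseteq> {fst (hd ps)..fst (last ps)} \<times> {snd (hd ps)..snd (last ps)}"
      using Cons.IH Cons.prems Cons by auto
    have step: "up_right_step p q" using Cons.prems Cons by auto
    have le: "fst p \<le> fst q" "snd p \<le> snd q"
      using step by (auto simp: up_right_step_def)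
    have "q \<in> {fst q..fst (last ps)} \<times> {snd q..snd (last ps)}"
      using IH Cons by auto
    then have le': "fst q \<le> fst (last ps)" "snd q \<le> snd (last ps)"
      by (cases q; auto)+
    have "set ps \<subseteq> {fst p..fst (last ps)} \<times> {snd p..snd (last ps)}"
      using IH le Cons by fastforce
    moreover have "p \<in> {fst p..fst (last ps)} \<times> {snd p..snd (last ps)}"
      using le le' by (cases p) auto
    ultimately show ?thesis using Cons by auto
  qed
qed

lemma finite_up_right_paths: "finite (up_right_paths u v)"
proof -
  have "up_right_paths u v \<subseteq> Pow ({fst u..fst v} \<times> {snd u..snd v})"
    unfolding up_right_paths_def using up_right_list_bounds by blast
  then show ?thesis by (rule finite_subset) simp
qed

lemma up_right_paths_nonempty:
  assumes "fst u \<le> fst v" "snd u \<le> snd v"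
  shows "up_right_paths u v \<noteq> {}"
proof -
  have "\<exists>ps. ps \<noteq> [] \<and> hd ps = u \<and> last ps = v \<and> successively up_right_step ps"
    using assms
  proof (induction "nat (fst v - fst u) + nat (snd v - snd u)" arbitrary: u)
    case 0
    then have "u = v" by (simp add: prod_eq_iff)
    then show ?case by (intro exI[of _ "[v]"]) simp
  next
    case (Suc n)
    define u' where "u' = (if fst u < fst v then u + (1, 0) else u + (0, 1))"
    have step: "up_right_step u u'" by (auto simp: u'_def up_right_step_def)
    have "n = nat (fst v - fst u') + nat (snd v - snd u')" "fst u' \<le> fst v" "snd u' \<le> snd v"
      using Suc.hyps(2) Suc.prems by (auto simp: u'_def)
    from Suc.hyps(1)[OF this] obtain ps
      where "ps \<noteq> []" "hd ps = u'" "last ps = v" "successively up_right_step ps" by blast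
    then show ?case
      using step by (intro exI[of _ "u # ps"]) (auto simp: successively_Cons)
  qed
  then show ?thesis unfolding up_right_paths_def by blast
qed

lemma exp_weights_tail:
  assumes "exp_weights M a b \<omega>" "a i + b j > 0" "t \<ge> 0"
  shows "measure M {s \<in> space M. \<omega> (i, j) s > t} = exp (- (a i + b j) * t)"
proof -
  interpret prob_space M using assms(1) by (simp add: exp_weights_def)
  show ?thesis
    using exponential_distributedD_gt[of "\<omega> (i, j)" "a i + b j" t] assms
    by (simp add: exp_weights_def algebra_simps)
qed

lemma measurable_last_passage:
  assumes "\<And>p. \<omega> p \<in> borel_measurable M" "fst u \<le> fst v" "snd u \<le> snd v"
  shows "(\<lambda>s. last_passage u v (\<lambda>p. \<omega> p s)) \<in> borel_measurable M"
proof -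
  have "(\<lambda>s. Max ((\<lambda>\<pi>. \<Sum>p\<in>\<pi>. \<omega> p s) ` up_right_paths u v)) \<in> borel_measurable M"
    using assms(1) finite_up_right_paths by (intro borel_measurable_Max) auto
  then show ?thesis by (simp add: last_passage_def)
qed

lemma measurable_last_passage_process:
  assumes "exp_weights M a b \<omega>"
  shows "(\<lambda>s. \<lambda>i\<in>perm_pairs \<sigma> \<tau>. (\<lambda>(x, y) s. last_passage x y (\<lambda>p. \<omega> p s)) i s)
           \<in> measurable M (\<Pi>\<^sub>M _\<in>perm_pairs \<sigma> \<tau>. borel)"
proof -
  interpret prob_space M using assms by (simp add: exp_weights_def)
  have "\<omega> p \<in> borel_measurable M" for p
    using assms unfolding exp_weights_def indep_vars_def by blast
  then show ?thesis
    by (intro measurable_restrict)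
      (auto simp: perm_pairs_def intro!: measurable_last_passage)
qed

lemma exp_weights_exist:
  assumes "\<And>i j. a i + b j > 0"
  shows "\<exists>(M :: (int \<times> int \<Rightarrow> real) measure) \<omega>. exp_weights M a b \<omega>"
proof -
  define D where "D = (\<lambda>(i, j). density lborel (exponential_density (a i + b j)))"
  have D: "prob_space (D p)" "sets (D p) = sets borel" for p
    using assms by (auto simp: D_def split: prod.split intro: prob_space_exponential_density)
  interpret D: product_prob_space D UNIV
    by (simp add: product_prob_space_def product_prob_space_axioms_def product_sigma_finite_def
          D prob_space_imp_sigma_finite)
  let ?M = "PiM UNIV D"
  let ?X = "\<lambda>p s. s p :: real"
  have rv: "?X p \<in> borel_measurable ?M" for p
  proof -
    have "?X p \<in> measurable ?M (D p)" by (rule measurable_component_singleton) simp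
    then show ?thesis using measurable_cong_sets[OF refl D(2)[of p]] by blast
  qed
  have law: "distr ?M borel (?X p) = D p" for p
  proof -
    have "distr ?M borel (?X p) = distr ?M (D p) (?X p)"
      by (rule distr_cong) (simp_all add: D)
    also have "\<dots> = D p" by (rule D.PiM_component) simp
    finally show ?thesis .
  qed
  have "distr ?M (\<Pi>\<^sub>M p\<in>UNIV. borel) (\<lambda>s. \<lambda>p\<in>UNIV. ?X p s) = distr ?M ?M (\<lambda>s. s)"
  proof (rule distr_cong)
    show "sets (\<Pi>\<^sub>M p\<in>UNIV. borel) = sets ?M" by (rule sets_PiM_cong) (simp_all add: D)
  qed (simp_all add: restrict_UNIV)
  also have "\<dots> = ?M" by (rule distr_id)
  also have "\<dots> = (\<Pi>\<^sub>M p\<in>UNIV. distr ?M borel (?X p))" by (simp only: law)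
  finally have "D.P.indep_vars (\<lambda>_. borel) ?X UNIV"
    by (subst D.P.indep_vars_iff_distr_eq_PiM) (simp_all only: rv UNIV_not_empty not_False_eq_True)
  moreover have "distributed ?M lborel (?X (i, j)) (exponential_density (a i + b j))" for i j
  proof -
    have "distr ?M lborel (?X (i, j)) = distr ?M borel (?X (i, j))"
      by (rule distr_cong) simp_all
    then show ?thesis using law[of "(i, j)"] rv[of "(i, j)"] by (simp add: distributed_def D_def)
  qed
  ultimately have "exp_weights ?M a b ?X"
    using D.P.prob_space_axioms unfolding exp_weights_def by blast
  then show ?thesis by blast
qed

end

theory Submission
  imports Defs
begin

text \<open>
  A finite permutation is sorted by adjacent transpositions at descents, and no cut point of the
  permutation lies inside a descent, so it suffices to exchange the rates of two adjacent columns
  \<open>k\<close> and \<open>k + 1\<close>, say with \<open>a k < a (k + 1)\<close>. This is done row by row with Burke's map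
  \<open>(z, w\<^sub>1, w\<^sub>2) \<mapsto> (w\<^sub>2 + (z - w\<^sub>1)\<^sup>+, min z w\<^sub>1, w\<^sub>2 + (w\<^sub>1 - z)\<^sup>+)\<close>, which sends independent exponentials
  of rates \<open>\<beta>, \<alpha>, \<alpha> + \<beta>\<close> to independent exponentials of rates \<open>\<beta>, \<alpha> + \<beta>, \<alpha>\<close>. Here \<open>w\<^sub>1, w\<^sub>2\<close> are
  the weights of the row in the two columns, and the auxiliary variable \<open>z\<close>, of rate
  \<open>\<beta> = a (k + 1) - a k\<close>, is carried to the next row. The map does not change the last-passage time
  of any rectangle that contains both columns or neither.
\<close>

section \<open>Recursion for last-passage times\<close>

lemma up_right_paths_singleton: "up_right_paths u u = {{u}}"
proof -
  have "ps = [u]" if "ps \<noteq> []" "hd ps = u" "last ps = u" "successively up_right_step ps" for ps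
  proof (cases ps)
    case (Cons p qs)
    have "qs = []"
    proof (rule ccontr)
      assume qs: "qs \<noteq> []"
      then have "up_right_step u (hd qs)" "successively up_right_step qs" "last qs = u"
        using that Cons by (auto simp: successively_Cons)
      with up_right_list_bounds[of qs] qs hd_in_set[OF qs] show False
        by (cases u) (auto simp: up_right_step_def)
    qed
    with Cons that show ?thesis by simp
  qed (use that in simp)
  moreover have "{u} \<in> up_right_paths u u"
    unfolding up_right_paths_def by (intro CollectI exI[of _ "[u]"]) simp
  ultimately show ?thesis unfolding up_right_paths_def by fastforce
qed

lemma up_right_path_bounds:
  "\<pi> \<in> up_right_paths u v \<Longrightarrow> \<pi> \<subseteq> {fst u..fst v} \<times> {snd u..snd v}"
  unfolding up_right_paths_def using up_right_list_bounds by blast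

text \<open>Deleting the last entry of the vertex list leaves a path to a predecessor of
  \<open>v\<close>; for \<open>u = v\<close> nothing might remain. One of the two path sets on the
  right may be empty, which gives the boundary cases of the recursion.\<close>

lemma up_right_paths_step:
  assumes "u \<noteq> v"
  shows "up_right_paths u v =
    insert v ` (up_right_paths u (v - (1, 0)) \<union> up_right_paths u (v - (0, 1)))" (is "_ = ?R")
proof (intro equalityI subsetI)
  fix \<pi> assume "\<pi> \<in> up_right_paths u v"
  then obtain ps where ps: "\<pi> = set ps" "ps \<noteq> []" "hd ps = u" "last ps = v"
    "successively up_right_step ps" unfolding up_right_paths_def by blast
  define qs where "qs = butlast ps"
  have eq: "ps = qs @ [v]" using append_butlast_last_id[OF ps(2)] ps(4) by (simp add: qs_def)
  with ps assms have qs: "qs \<noteq> []" by auto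
  with ps(5) eq have "successively up_right_step qs" "up_right_step (last qs) v"
    by (auto simp: successively_append_iff)
  moreover from this(2) have "last qs = v - (1, 0) \<or> last qs = v - (0, 1)"
    by (auto simp: up_right_step_def)
  moreover have "hd qs = u" using ps eq qs by auto
  ultimately have "set qs \<in> up_right_paths u (v - (1, 0)) \<union> up_right_paths u (v - (0, 1))"
    using qs unfolding up_right_paths_def by blast
  then show "\<pi> \<in> ?R" using ps(1) eq by (intro image_eqI[of _ _ "set qs"]) auto
next
  fix \<pi> assume "\<pi> \<in> ?R"
  then obtain qs where qs: "\<pi> = insert v (set qs)" "qs \<noteq> []" "hd qs = u"
    "last qs = v - (1, 0) \<or> last qs = v - (0, 1)" "successively up_right_step qs"
    unfolding up_right_paths_def by blast
  then have "up_right_step (last qs) v" by (auto simp: up_right_step_def)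
  with qs show "\<pi> \<in> up_right_paths u v"
    unfolding up_right_paths_def
    by (intro CollectI exI[of _ "qs @ [v]"]) (auto simp: successively_append_iff)
qed

lemma up_right_paths_empty: "\<not> (fst u \<le> fst v \<and> snd u \<le> snd v) \<Longrightarrow> up_right_paths u v = {}"
proof (rule ccontr)
  assume *: "\<not> (fst u \<le> fst v \<and> snd u \<le> snd v)" and "up_right_paths u v \<noteq> {}"
  then obtain ps where "ps \<noteq> []" "hd ps = u" "last ps = v" "successively up_right_step ps"
    unfolding up_right_paths_def by blast
  with up_right_list_bounds[of ps] hd_in_set[of ps] show False
    using * by (cases u; cases v) auto
qed

text \<open>Reflection in the diagonal exchanges the two kinds of step. It later turns statements
  about columns into statements about rows.\<close>

lemma up_right_paths_swap:
  "up_right_paths (prod.swap u) (prod.swap v) = (`) prod.swap ` up_right_paths u v"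
proof -
  have step: "up_right_step (prod.swap p) (prod.swap q) \<longleftrightarrow> up_right_step p q" for p q
    by (cases p; cases q) (auto simp: up_right_step_def)
  have "prod.swap ` \<pi> \<in> up_right_paths (prod.swap u) (prod.swap v)"
    if "\<pi> \<in> up_right_paths u v" for \<pi> u v
  proof -
    from that obtain ps where "\<pi> = set ps" "ps \<noteq> []" "hd ps = u" "last ps = v"
      "successively up_right_step ps" unfolding up_right_paths_def by blast
    then show ?thesis unfolding up_right_paths_def
      by (intro CollectI exI[of _ "map prod.swap ps"])
        (simp add: hd_map last_map successively_map step)
  qed
  note sub = this
  show ?thesis
  proof (intro equalityI subsetI)
    fix \<pi> assume "\<pi> \<in> up_right_paths (prod.swap u) (prod.swap v)"
    from sub[OF this] show "\<pi> \<in> (`) prod.swap ` up_right_paths u v"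
      by (intro image_eqI[of _ _ "prod.swap ` \<pi>"]) (simp_all add: image_comp)
  qed (auto intro: sub)
qed

lemma last_passage_cong:
  assumes "\<And>p. p \<in> {fst u..fst v} \<times> {snd u..snd v} \<Longrightarrow> w p = w' p"
  shows "last_passage u v w = last_passage u v w'"
  unfolding last_passage_def
  by (intro arg_cong[where f = Max] image_cong refl sum.cong)
    (use assms up_right_path_bounds in blast)+

lemma last_passage_swap:
  "last_passage (prod.swap u) (prod.swap v) w = last_passage u v (\<lambda>p. w (prod.swap p))"
  unfolding last_passage_def up_right_paths_swap image_image
  by (simp add: sum.reindex)

lemma last_passage_self [simp]: "last_passage u u w = w u"
  by (simp add: last_passage_def up_right_paths_singleton)

text \<open>A path to a predecessor of \<open>v\<close> stays in a box that misses \<open>v\<close>,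
  so \<open>w v\<close> is added exactly once and comes out of the maximum. \<open>P\<close> is left
  general to serve both the interior recursion and the boundary ones, where one predecessor is
  unreachable.\<close>

lemma Max_insert_weights:
  assumes "u \<noteq> v" "P \<noteq> {}" "P \<subseteq> up_right_paths u (v - (1, 0)) \<union> up_right_paths u (v - (0, 1))"
  shows "Max ((\<lambda>\<pi>. \<Sum>p\<in>\<pi>. w p) ` insert v ` P) = w v + Max ((\<lambda>\<pi>. \<Sum>p\<in>\<pi>. w p :: real) ` P)"
proof -
  have fin: "finite P"
    using finite_subset[OF assms(3)] finite_up_right_paths by blast
  have "(\<Sum>p\<in>insert v \<pi>. w p) = w v + (\<Sum>p\<in>\<pi>. w p)" if "\<pi> \<in> P" for \<pi>
  proof -
    have "\<pi> \<subseteq> {fst u..fst v} \<times> {snd u..snd v}" "v \<notin> \<pi>"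
      using assms(3) that up_right_path_bounds[of \<pi> u] by (cases v; fastforce)+
    then have "finite \<pi>" using finite_subset by blast
    with \<open>v \<notin> \<pi>\<close> show ?thesis by simp
  qed
  then have "(\<lambda>\<pi>. \<Sum>p\<in>\<pi>. w p) ` insert v ` P = (\<lambda>x. w v + x) ` (\<lambda>\<pi>. \<Sum>p\<in>\<pi>. w p) ` P"
    by (simp add: image_image)
  then show ?thesis
    using hom_Max_commute[of "\<lambda>x. w v + x" "(\<lambda>\<pi>. \<Sum>p\<in>\<pi>. w p) ` P"] fin assms(2)
    by (simp add: max_add_distrib_right)
qed

lemma last_passage_max:
  assumes "fst u < fst v" "snd u < snd v"
  shows "last_passage u v w =
    w v + max (last_passage u (v - (1, 0)) w) (last_passage u (v - (0, 1)) w)"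
proof -
  have "up_right_paths u (v - (1, 0)) \<noteq> {}" "up_right_paths u (v - (0, 1)) \<noteq> {}" "u \<noteq> v"
    using assms by (auto simp: up_right_paths_nonempty)
  then show ?thesis
    unfolding last_passage_def
    by (simp add: up_right_paths_step Max_insert_weights image_Un Max_Un finite_up_right_paths
        flip: image_Un)
      (simp add: image_Un Max_Un finite_up_right_paths)
qed

lemma last_passage_vertical:
  assumes "fst u = fst v" "snd u < snd v"
  shows "last_passage u v w = w v + last_passage u (v - (0, 1)) w"
proof -
  have "up_right_paths u (v - (1, 0)) = {}" "up_right_paths u (v - (0, 1)) \<noteq> {}" "u \<noteq> v"
    using assms by (auto simp: up_right_paths_nonempty up_right_paths_empty)
  then show ?thesis
    unfolding last_passage_def by (simp add: up_right_paths_step Max_insert_weights)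
qed

lemma last_passage_horizontal:
  assumes "fst u < fst v" "snd u = snd v"
  shows "last_passage u v w = w v + last_passage u (v - (1, 0)) w"
proof -
  have "up_right_paths u (v - (0, 1)) = {}" "up_right_paths u (v - (1, 0)) \<noteq> {}" "u \<noteq> v"
    using assms by (auto simp: up_right_paths_nonempty up_right_paths_empty)
  then show ?thesis
    unfolding last_passage_def by (simp add: up_right_paths_step Max_insert_weights)
qed

section \<open>Invariance of last-passage times\<close>

text \<open>One row of the induction in \<open>burke_columns\<close>: \<open>F\<close> and
  \<open>E\<close> are the times of columns \<open>k\<close> and \<open>k + 1\<close> one row below,
  \<open>H\<close> is the time entering column \<open>k\<close> from the left, and primes mark
  values for the modified weights, except that \<open>z'\<close> is the next carry. \<open>E\<close>
  has no primed version because its invariance is part of the induction hypothesis.\<close>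

lemma burke_invariant_step:
  fixes F F' E z H w1 w2 :: real
  assumes "F' \<le> F" "E - F \<le> z" "F' = F \<or> E - F = z"
  defines "f \<equiv> w1 + max F H" and "f' \<equiv> min z w1 + max F' H"
  defines "e \<equiv> w2 + max f E" and "e' \<equiv> (w2 + max 0 (w1 - z)) + max f' E"
    and "z' \<equiv> w2 + max 0 (z - w1)"
  shows "e' = e \<and> f' \<le> f \<and> e - f \<le> z' \<and> (f' = f \<or> e - f = z')"
  using assms by (auto simp: max_def min_def split: if_splits)

text \<open>Start of that induction, in the lowest row of the rectangle. Here \<open>z\<close> is
  arbitrary, so whatever has been carried up from rows below the rectangle does no harm.\<close>

lemma burke_invariant_base:
  fixes h z w1 w2 :: real
  defines "f \<equiv> w1 + h" and "f' \<equiv> min z w1 + h"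
  defines "e \<equiv> w2 + f" and "e' \<equiv> (w2 + max 0 (w1 - z)) + f'"
    and "z' \<equiv> w2 + max 0 (z - w1)"
  shows "e' = e \<and> f' \<le> f \<and> e - f \<le> z' \<and> (f' = f \<or> e - f = z')"
  unfolding assms by (auto simp: max_def min_def)

context
  fixes k m n :: int and z :: "int \<Rightarrow> real" and w w' :: "int \<times> int \<Rightarrow> real"
  assumes outside: "\<And>i j. i \<noteq> k \<Longrightarrow> i \<noteq> k + 1 \<Longrightarrow> m \<le> j \<Longrightarrow> w' (i, j) = w (i, j)"
    and left: "\<And>j. m \<le> j \<Longrightarrow> j \<le> n \<Longrightarrow> w' (k, j) = min (z (j - 1)) (w (k, j))"
    and right: "\<And>j. m \<le> j \<Longrightarrow> j \<le> n \<Longrightarrow>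
      w' (k + 1, j) = w (k + 1, j) + max 0 (w (k, j) - z (j - 1))"
    and carry: "\<And>j. m \<le> j \<Longrightarrow> j \<le> n \<Longrightarrow>
      z j = w (k + 1, j) + max 0 (z (j - 1) - w (k, j))"
begin

text \<open>
  If \<open>E\<close> and \<open>F\<close> are the passage times to row \<open>j\<close> of columns \<open>k + 1\<close> and \<open>k\<close>, then \<open>E - F\<close> obeys the
  recursion of \<open>z\<close> from a smaller start; \<open>F\<close> can change only after the two have coalesced.
\<close>
lemma burke_columns:
  assumes "x1 \<le> k" "m \<le> x2" "x2 \<le> j" "j \<le> n"
  defines "L \<equiv> \<lambda>v. last_passage (x1, x2) v"
  shows "L (k + 1, j) w' = L (k + 1, j) w \<and> L (k, j) w' \<le> L (k, j) w \<and>
    L (k + 1, j) w - L (k, j) w \<le> z j \<and>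
    (L (k, j) w' = L (k, j) w \<or> L (k + 1, j) w - L (k, j) w = z j)"
  using assms(3,4)
proof (induction j rule: int_ge_induct)
  have H: "L (k - 1, j) w' = L (k - 1, j) w" if "x2 \<le> j" for j
    unfolding L_def using assms(2) by (intro last_passage_cong) (auto simp: outside)
  {
    case base
    have E: "L (k + 1, x2) v = v (k + 1, x2) + L (k, x2) v" for v
      using assms(1) by (simp add: L_def last_passage_horizontal)
    \<comment> \<open>\<open>h\<close> collects what comes from the columns left of
      \<open>k\<close>. It is the same for \<open>w\<close> and \<open>w'\<close>, and it is 0 when
      the rectangle starts in column \<open>k\<close>.\<close>
    obtain h where F: "\<And>v. v \<in> {w, w'} \<Longrightarrow> L (k, x2) v = v (k, x2) + h"
    proof (cases "x1 = k")
      case True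
      show ?thesis by (rule that[of 0]) (simp add: L_def True)
    next
      case False
      then have *: "L (k, x2) v = v (k, x2) + L (k - 1, x2) v" for v
        using assms(1) by (simp add: L_def last_passage_horizontal)
      show ?thesis
        by (rule that[of "L (k - 1, x2) w"]) (use H[of x2] in \<open>auto simp: *\<close>)
    qed
    have row: "w' (k, x2) = min (z (x2 - 1)) (w (k, x2))"
      "w' (k + 1, x2) = w (k + 1, x2) + max 0 (w (k, x2) - z (x2 - 1))"
      "z x2 = w (k + 1, x2) + max 0 (z (x2 - 1) - w (k, x2))"
      using left right carry base assms(2) by blast+
    have F': "L (k, x2) w = w (k, x2) + h" "L (k, x2) w' = w' (k, x2) + h"
      using F by simp_all
    show ?case
      unfolding E F' row by (rule burke_invariant_base)
  next
    case (step j)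
    have E: "L (k + 1, j + 1) v = v (k + 1, j + 1) + max (L (k, j + 1) v) (L (k + 1, j) v)" for v
      using assms(1) step(1) by (simp add: L_def last_passage_max)
    obtain h where h: "\<And>v. v \<in> {w, w'} \<Longrightarrow> L (k, j + 1) v = v (k, j + 1) + max (L (k, j) v) h"
    proof (cases "x1 = k")
      case True
      have "L (k, j + 1) v = v (k, j + 1) + L (k, j) v" for v
        using True step(1) by (simp add: L_def last_passage_vertical)
      \<comment> \<open>Without a column to the left, \<open>h\<close> must be a number that never
        changes the maximum: the smaller of the two times below serves for \<open>w\<close> and
        \<open>w'\<close> alike.\<close>
      then have "L (k, j + 1) v = v (k, j + 1) + max (L (k, j) v) (min (L (k, j) w) (L (k, j) w'))"
        if "v \<in> {w, w'}" for v
        using that by (auto simp: max_def min_def)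
      then show ?thesis using that by blast
    next
      case False
      have *: "L (k, j + 1) v = v (k, j + 1) + max (L (k, j) v) (L (k - 1, j + 1) v)" for v
        using False assms(1) step(1) by (simp add: L_def last_passage_max max.commute)
      show ?thesis
        using H[of "j + 1"] step(1) by (intro that[of "L (k - 1, j + 1) w"]) (auto simp: *)
    qed
    have eq: "L (k + 1, j) w' = L (k + 1, j) w" and
      *: "L (k, j) w' \<le> L (k, j) w" "L (k + 1, j) w - L (k, j) w \<le> z j"
      "L (k, j) w' = L (k, j) w \<or> L (k + 1, j) w - L (k, j) w = z j"
      using step by auto
    have "m \<le> j + 1" using step(1) assms(2) by simp
    then have row: "w' (k, j + 1) = min (z j) (w (k, j + 1))"
      "w' (k + 1, j + 1) = w (k + 1, j + 1) + max 0 (w (k, j + 1) - z j)"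
      "z (j + 1) = w (k + 1, j + 1) + max 0 (z j - w (k, j + 1))"
      using left[of "j + 1"] right[of "j + 1"] carry[of "j + 1"] step(3) by simp_all
    have h': "L (k, j + 1) w = w (k, j + 1) + max (L (k, j) w) h"
      "L (k, j + 1) w' = w' (k, j + 1) + max (L (k, j) w') h"
      using h by simp_all
    show ?case
      unfolding E h' row eq using * by (rule burke_invariant_step)
  }
qed

text \<open>The two excluded cases are exactly those in which the rectangle meets only one of the
  columns \<open>k\<close> and \<open>k + 1\<close>. If it meets neither, no weight in it changes;
  if it meets both, \<open>burke_columns\<close> settles column \<open>k + 1\<close>, and the
  recursion carries the equality further right, where the weights agree.\<close>

lemma burke_last_passage:
  assumes "x1 \<le> y1" "x2 \<le> y2" "x1 \<noteq> k + 1" "y1 \<noteq> k" "m \<le> x2" "y2 \<le> n"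
  shows "last_passage (x1, x2) (y1, y2) w' = last_passage (x1, x2) (y1, y2) w"
proof (cases "x1 \<le> k \<and> k + 1 \<le> y1")
  case False
  with assms show ?thesis
    by (intro last_passage_cong) (auto intro!: outside)
next
  case True
  then have x1: "x1 \<le> k" and y1: "k + 1 \<le> y1" by auto
  show ?thesis using y1 assms(2,6)
  \<comment> \<open>The height \<open>y2\<close> stays general: the inner induction on rows needs
    the previous column at each new height.\<close>
  proof (induction y1 arbitrary: y2 rule: int_ge_induct)
    case base
    then show ?case using burke_columns[OF x1 assms(5) base] by simp
  next
    case (step i)
    have out: "w' (i + 1, j) = w (i + 1, j)" if "x2 \<le> j" for j
      using step(1) that assms(5) by (intro outside) auto
    note i = step(1) and IH = step.IH
    show ?case using step(3,4)
    proof (induction y2 rule: int_ge_induct)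
      case base
      have "last_passage (x1, x2) (i + 1, x2) v = v (i + 1, x2) + last_passage (x1, x2) (i, x2) v" for v
        using last_passage_horizontal[of "(x1, x2)" "(i + 1, x2)" v] i x1 by simp
      then show ?case using IH[of x2] out[of x2] base by simp
    next
      case (step j)
      have "last_passage (x1, x2) (i + 1, j + 1) v = v (i + 1, j + 1) +
          max (last_passage (x1, x2) (i, j + 1) v) (last_passage (x1, x2) (i + 1, j) v)" for v
        using last_passage_max[of "(x1, x2)" "(i + 1, j + 1)" v] i x1 step(1) by simp
      then show ?case using IH[of "j + 1"] out[of "j + 1"] step by simp
    qed
  qed
qed

end

section \<open>Burke's theorem for exponential variables\<close>

lemma nn_integral_translate:
  fixes g :: "real \<Rightarrow> ennreal"
  assumes [measurable]: "g \<in> borel_measurable borel"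
  shows "(\<integral>\<^sup>+x. g (c + x) \<partial>lborel) = (\<integral>\<^sup>+x. g x \<partial>lborel)"
  using nn_integral_real_affine[of g 1 c] by simp

text \<open>The cut at \<open>c\<close> will separate the two branches of Burke's map, with the
  upper part written in terms of the excess \<open>t\<close> over the cut.\<close>

lemma nn_integral_split_real:
  fixes g :: "real \<Rightarrow> ennreal"
  assumes [measurable]: "g \<in> borel_measurable borel"
  shows "(\<integral>\<^sup>+x. g x \<partial>lborel) =
    (\<integral>\<^sup>+t. g (c + t) * indicator {0<..} t \<partial>lborel) + (\<integral>\<^sup>+x. g x * (if x \<le> c then 1 else 0) \<partial>lborel)"
proof -
  have "(\<integral>\<^sup>+x. g x \<partial>lborel) = (\<integral>\<^sup>+x. g x * indicator {c<..} x + g x * (if x \<le> c then 1 else 0) \<partial>lborel)"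
    by (intro nn_integral_cong) (auto simp: indicator_def)
  also have "\<dots> = (\<integral>\<^sup>+x. g x * indicator {c<..} x \<partial>lborel) + (\<integral>\<^sup>+x. g x * (if x \<le> c then 1 else 0) \<partial>lborel)"
    by (intro nn_integral_add) auto
  also have "(\<integral>\<^sup>+x. g x * indicator {c<..} x \<partial>lborel) = (\<integral>\<^sup>+t. g (c + t) * indicator {0<..} t \<partial>lborel)"
    by (subst nn_integral_translate[of _ c, symmetric]) (auto intro!: nn_integral_cong simp: indicator_def)
  finally show ?thesis .
qed

abbreviation exp_law :: "real \<Rightarrow> real measure" where
  "exp_law l \<equiv> density lborel (\<lambda>x. ennreal (exponential_density l x))"

lemma nn_integral_exp_law3:
  fixes G :: "real \<Rightarrow> real \<Rightarrow> real \<Rightarrow> ennreal"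
  assumes [measurable]: "(\<lambda>(v, y, x). G v y x) \<in> borel_measurable (borel \<Otimes>\<^sub>M borel \<Otimes>\<^sub>M borel)"
  shows "(\<integral>\<^sup>+v. \<integral>\<^sup>+y. \<integral>\<^sup>+x. G v y x \<partial>exp_law l1 \<partial>exp_law l2 \<partial>exp_law l3) =
     (\<integral>\<^sup>+v. \<integral>\<^sup>+y. \<integral>\<^sup>+x. ennreal (exponential_density l1 x) * ennreal (exponential_density l2 y) *
        ennreal (exponential_density l3 v) * G v y x \<partial>lborel \<partial>lborel \<partial>lborel)"
proof -
  define e where "e = (\<lambda>l x. ennreal (exponential_density l x))"
  have e [measurable]: "e l \<in> borel_measurable borel" for l by (simp add: e_def)
  have G [measurable]: "(\<lambda>p. G (a p) (b p) (c p)) \<in> borel_measurable N"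
    if [measurable]: "a \<in> borel_measurable N" "b \<in> borel_measurable N" "c \<in> borel_measurable N"
    for N :: "'z measure" and a b c
    using measurable_compose[OF _ assms, of "\<lambda>p. (a p, b p, c p)" N] by simp
  have "(\<integral>\<^sup>+v. \<integral>\<^sup>+y. \<integral>\<^sup>+x. G v y x \<partial>density lborel (e l1) \<partial>density lborel (e l2) \<partial>density lborel (e l3)) =
     (\<integral>\<^sup>+v. \<integral>\<^sup>+y. e l2 y * (\<integral>\<^sup>+x. e l1 x * G v y x \<partial>lborel) \<partial>lborel \<partial>density lborel (e l3))"
    by (simp add: nn_integral_density)
  also have "\<dots> = (\<integral>\<^sup>+v. e l3 v * (\<integral>\<^sup>+y. e l2 y * (\<integral>\<^sup>+x. e l1 x * G v y x \<partial>lborel) \<partial>lborel) \<partial>lborel)"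
    by (rule nn_integral_density) measurable
  also have "\<dots> = (\<integral>\<^sup>+v. \<integral>\<^sup>+y. \<integral>\<^sup>+x. e l1 x * e l2 y * e l3 v * G v y x \<partial>lborel \<partial>lborel \<partial>lborel)"
    by (simp add: nn_integral_cmult[symmetric] mult_ac)
  finally show ?thesis by (simp add: e_def)
qed

lemma Fubini_lborel:
  assumes [measurable]: "(\<lambda>(x, y). g x y) \<in> borel_measurable (borel \<Otimes>\<^sub>M borel)"
  shows "(\<integral>\<^sup>+y. \<integral>\<^sup>+x. g x y \<partial>lborel \<partial>(lborel :: real measure)) =
    (\<integral>\<^sup>+x. \<integral>\<^sup>+y. g x y \<partial>lborel \<partial>(lborel :: real measure))"
  by (rule lborel_pair.Fubini') simp

text \<open>On each branch Burke's map is a change of variables with unit Jacobian: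
  \<open>(y + t, y, v)\<close> goes to \<open>(v + t, y, v)\<close> for \<open>t > 0\<close>, and
  \<open>(x, x + t, v)\<close> goes to \<open>(v, x, v + t)\<close> for \<open>t \<ge> 0\<close>.
  The product densities at both ends agree. The images are the parts \<open>x > v\<close> and
  \<open>x \<le> v\<close>, which together exhaust the target.\<close>

lemma burke_nn_integral:
  fixes f :: "real \<Rightarrow> real \<Rightarrow> real \<Rightarrow> ennreal"
  assumes f [measurable]: "(\<lambda>(x, y, v). f x y v) \<in> borel_measurable (borel \<Otimes>\<^sub>M borel \<Otimes>\<^sub>M borel)"
    and pos: "0 < \<alpha>" "0 < \<beta>"
  shows "(\<integral>\<^sup>+v. \<integral>\<^sup>+y. \<integral>\<^sup>+x. f (v + max 0 (x - y)) (min x y) (v + max 0 (y - x))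
            \<partial>exp_law \<beta> \<partial>exp_law \<alpha> \<partial>exp_law (\<alpha> + \<beta>)) =
         (\<integral>\<^sup>+v. \<integral>\<^sup>+y. \<integral>\<^sup>+x. f x y v \<partial>exp_law \<beta> \<partial>exp_law (\<alpha> + \<beta>) \<partial>exp_law \<alpha>)"
    (is "?L = ?R")
proof -
  define e where "e = (\<lambda>l x. ennreal (exponential_density l x))"
  have e [measurable]: "e l \<in> borel_measurable borel" for l by (simp add: e_def)
  have f3 [measurable]: "(\<lambda>p. f (a p) (b p) (c p)) \<in> borel_measurable N"
    if [measurable]: "a \<in> borel_measurable N" "b \<in> borel_measurable N" "c \<in> borel_measurable N"
    for N :: "'z measure" and a b c
    using measurable_compose[OF _ f, of "\<lambda>p. (a p, b p, c p)" N] by simp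
  let ?I = "indicator {0<..} :: real \<Rightarrow> ennreal"
  let ?F = "\<lambda>v y x. f (v + max 0 (x - y)) (min x y) (v + max 0 (y - x))"
  have e0: "e l x = 0" if "x < 0" for l x
    using that by (simp add: e_def exponential_density_def)
  have e_pos: "e l x = ennreal (l * exp (- x * l))" if "\<not> x < 0" for l x
    using that by (simp add: e_def exponential_density_def)
  \<comment> \<open>Up to sign, both exponents equal
    \<open>\<beta> * t + (\<alpha> + \<beta>) * (y + v)\<close>, and the prefactors are permuted.
    For negative \<open>y\<close> or \<open>v\<close> both sides vanish.\<close>
  have gt: "e \<beta> (y + t) * e \<alpha> y * e (\<alpha> + \<beta>) v * ?I t =
      e \<beta> (v + t) * e (\<alpha> + \<beta>) y * e \<alpha> v * ?I t" for y t v
  proof (cases "y < 0 \<or> v < 0 \<or> t \<le> 0")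
    case False
    then have "\<not> y + t < 0" "\<not> v + t < 0" "\<not> y < 0" "\<not> v < 0" by auto
    then show ?thesis using pos
      by (simp add: e_pos ennreal_mult[symmetric] algebra_simps flip: exp_add)
  qed (auto simp: e0)
  \<comment> \<open>Here the common exponent is, up to sign,
    \<open>\<alpha> * t + (\<alpha> + \<beta>) * (x + v)\<close>.\<close>
  have le: "e \<beta> x * e \<alpha> (x + t) * e (\<alpha> + \<beta>) v =
      e \<beta> v * e (\<alpha> + \<beta>) x * e \<alpha> (v + t)" if "0 \<le> t" for x t v
  proof (cases "x < 0 \<or> v < 0")
    case False
    then have "\<not> x + t < 0" "\<not> v + t < 0" "\<not> x < 0" "\<not> v < 0" using that by auto
    then show ?thesis using pos
      by (simp add: e_pos ennreal_mult[symmetric] algebra_simps flip: exp_add)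
  qed (auto simp: e0)
  have "?L = (\<integral>\<^sup>+v. \<integral>\<^sup>+y. \<integral>\<^sup>+x. e \<beta> x * e \<alpha> y * e (\<alpha> + \<beta>) v * ?F v y x \<partial>lborel \<partial>lborel \<partial>lborel)"
    unfolding e_def by (rule nn_integral_exp_law3) measurable
  also have "\<dots> = (\<integral>\<^sup>+v. \<integral>\<^sup>+y. (\<integral>\<^sup>+t. e \<beta> (y + t) * e \<alpha> y * e (\<alpha> + \<beta>) v * ?F v y (y + t) * ?I t \<partial>lborel) +
      (\<integral>\<^sup>+x. e \<beta> x * e \<alpha> y * e (\<alpha> + \<beta>) v * ?F v y x * (if x \<le> y then 1 else 0) \<partial>lborel) \<partial>lborel \<partial>lborel)"
    by (intro nn_integral_cong nn_integral_split_real) measurable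
  also have "\<dots> = (\<integral>\<^sup>+v. \<integral>\<^sup>+y. \<integral>\<^sup>+t. e \<beta> (y + t) * e \<alpha> y * e (\<alpha> + \<beta>) v * ?F v y (y + t) * ?I t \<partial>lborel \<partial>lborel \<partial>lborel) +
      (\<integral>\<^sup>+v. \<integral>\<^sup>+y. \<integral>\<^sup>+x. e \<beta> x * e \<alpha> y * e (\<alpha> + \<beta>) v * ?F v y x * (if x \<le> y then 1 else 0) \<partial>lborel \<partial>lborel \<partial>lborel)"
    (is "_ = ?A + ?B") by (simp add: nn_integral_add)
  finally have L: "?L = ?A + ?B" .
  have "?R = (\<integral>\<^sup>+v. \<integral>\<^sup>+y. \<integral>\<^sup>+x. e \<beta> x * e (\<alpha> + \<beta>) y * e \<alpha> v * f x y v \<partial>lborel \<partial>lborel \<partial>lborel)"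
    unfolding e_def by (rule nn_integral_exp_law3) measurable
  also have "\<dots> = (\<integral>\<^sup>+v. \<integral>\<^sup>+y. (\<integral>\<^sup>+t. e \<beta> (v + t) * e (\<alpha> + \<beta>) y * e \<alpha> v * f (v + t) y v * ?I t \<partial>lborel) +
      (\<integral>\<^sup>+x. e \<beta> x * e (\<alpha> + \<beta>) y * e \<alpha> v * f x y v * (if x \<le> v then 1 else 0) \<partial>lborel) \<partial>lborel \<partial>lborel)"
    by (intro nn_integral_cong nn_integral_split_real) measurable
  also have "\<dots> = (\<integral>\<^sup>+v. \<integral>\<^sup>+y. \<integral>\<^sup>+t. e \<beta> (v + t) * e (\<alpha> + \<beta>) y * e \<alpha> v * f (v + t) y v * ?I t \<partial>lborel \<partial>lborel \<partial>lborel) +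
      (\<integral>\<^sup>+v. \<integral>\<^sup>+y. \<integral>\<^sup>+x. e \<beta> x * e (\<alpha> + \<beta>) y * e \<alpha> v * f x y v * (if x \<le> v then 1 else 0) \<partial>lborel \<partial>lborel \<partial>lborel)"
    (is "_ = ?A' + ?B'") by (simp add: nn_integral_add)
  finally have R: "?R = ?A' + ?B'" .
  \<comment> \<open>In the branch \<open>x > y\<close> the integrands coincide pointwise in
    \<open>(v, y, t)\<close>, so no further change of variables is needed.\<close>
  have "e \<beta> (y + t) * e \<alpha> y * e (\<alpha> + \<beta>) v * ?F v y (y + t) * ?I t =
      e \<beta> (v + t) * e (\<alpha> + \<beta>) y * e \<alpha> v * f (v + t) y v * ?I t" for v y t
    using gt[of y t v] by (cases "0 < t") (simp_all add: max_def min_def)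
  then have A: "?A = ?A'" by simp
  \<comment> \<open>In the other branch \<open>y\<close> has to become the innermost variable, since
    it is the one replaced by \<open>x + t\<close>.\<close>
  have "?B = (\<integral>\<^sup>+v. \<integral>\<^sup>+x. \<integral>\<^sup>+y. e \<beta> x * e \<alpha> y * e (\<alpha> + \<beta>) v * ?F v y x * (if x \<le> y then 1 else 0) \<partial>lborel \<partial>lborel \<partial>lborel)"
    by (intro nn_integral_cong Fubini_lborel) measurable
  also have "\<dots> = (\<integral>\<^sup>+v. \<integral>\<^sup>+x. \<integral>\<^sup>+t. e \<beta> x * e \<alpha> (x + t) * e (\<alpha> + \<beta>) v * ?F v (x + t) x * (if x \<le> x + t then 1 else 0) \<partial>lborel \<partial>lborel \<partial>lborel)"
    by (intro nn_integral_cong nn_integral_translate[symmetric]) measurable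
  \<comment> \<open>The outer bound variables change roles: the old \<open>v\<close> is the first
    output and is now called \<open>x\<close>, the old \<open>x\<close> is the minimum and is now
    called \<open>y\<close>. Afterwards the shift is undone and the order of integration
    restored.\<close>
  also have "\<dots> = (\<integral>\<^sup>+x. \<integral>\<^sup>+y. \<integral>\<^sup>+t. e \<beta> x * e (\<alpha> + \<beta>) y * e \<alpha> (x + t) * f x y (x + t) * (if x \<le> x + t then 1 else 0) \<partial>lborel \<partial>lborel \<partial>lborel)"
  proof (intro nn_integral_cong)
    fix v x t
    show "e \<beta> x * e \<alpha> (x + t) * e (\<alpha> + \<beta>) v * ?F v (x + t) x * (if x \<le> x + t then 1 else 0) =
      e \<beta> v * e (\<alpha> + \<beta>) x * e \<alpha> (v + t) * f v x (v + t) * (if v \<le> v + t then 1 else 0)"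
      using le[of t x v] by (cases "0 \<le> t") (simp_all add: max_def min_def)
  qed
  also have "\<dots> = (\<integral>\<^sup>+x. \<integral>\<^sup>+y. \<integral>\<^sup>+v. e \<beta> x * e (\<alpha> + \<beta>) y * e \<alpha> v * f x y v * (if x \<le> v then 1 else 0) \<partial>lborel \<partial>lborel \<partial>lborel)"
    by (intro nn_integral_cong nn_integral_translate) measurable
  also have "\<dots> = (\<integral>\<^sup>+x. \<integral>\<^sup>+v. \<integral>\<^sup>+y. e \<beta> x * e (\<alpha> + \<beta>) y * e \<alpha> v * f x y v * (if x \<le> v then 1 else 0) \<partial>lborel \<partial>lborel \<partial>lborel)"
    by (intro nn_integral_cong Fubini_lborel) measurable
  also have "\<dots> = (\<integral>\<^sup>+v. \<integral>\<^sup>+x. \<integral>\<^sup>+y. e \<beta> x * e (\<alpha> + \<beta>) y * e \<alpha> v * f x y v * (if x \<le> v then 1 else 0) \<partial>lborel \<partial>lborel \<partial>lborel)"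
    by (rule Fubini_lborel) measurable
  also have "\<dots> = ?B'"
    by (intro nn_integral_cong Fubini_lborel) measurable
  finally have "?B = ?B'" .
  with A L R show ?thesis by simp
qed

section \<open>Product measures of exponential laws and the update of three sites\<close>

definition exp_prod :: "'i set \<Rightarrow> ('i \<Rightarrow> real) \<Rightarrow> ('i \<Rightarrow> real) measure" where
  "exp_prod S p = (\<Pi>\<^sub>M i\<in>S. exp_law (p i))"

lemma sets_exp_prod [measurable_cong]: "sets (exp_prod S p) = sets (\<Pi>\<^sub>M i\<in>S. borel)"
  unfolding exp_prod_def by (rule sets_PiM_cong) simp_all

lemma space_exp_prod: "space (exp_prod S p) = space (\<Pi>\<^sub>M i\<in>S. (borel :: real measure))"
  by (rule sets_eq_imp_space_eq[OF sets_exp_prod])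

lemma product_prob_space_exp_law:
  assumes "\<And>i. 0 < p i"
  shows "product_prob_space (\<lambda>i. exp_law (p i))"
  using assms
  by (simp add: product_prob_space_def product_prob_space_axioms_def product_sigma_finite_def
      prob_space_imp_sigma_finite prob_space_exponential_density)

lemma exp_prod_cong: "(\<And>i. i \<in> S \<Longrightarrow> p i = p' i) \<Longrightarrow> exp_prod S p = exp_prod S p'"
  unfolding exp_prod_def by (rule PiM_cong) simp_all

lemma exp_prod_restrict:
  assumes "finite S" "S' \<subseteq> S" "\<And>i. 0 < p i"
  shows "exp_prod S' p = distr (exp_prod S p) (\<Pi>\<^sub>M i\<in>S'. borel) (\<lambda>w. restrict w S')"
proof -
  interpret product_prob_space "\<lambda>i. exp_law (p i)"
    by (rule product_prob_space_exp_law) fact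
  show ?thesis
    unfolding exp_prod_def
    by (rule trans[OF distr_restrict[OF assms(2,1)] distr_cong])
      (simp_all flip: exp_prod_def add: sets_exp_prod)
qed

text \<open>Integrates out a single site. The measurability of the inner integral makes the rule
  applicable again, one site at a time.\<close>

lemma nn_integral_exp_prod_insert:
  assumes "finite I" "i \<notin> I" "\<And>i. 0 < p i"
    and f: "f \<in> borel_measurable (\<Pi>\<^sub>M i\<in>insert i I. borel)"
  shows "(\<integral>\<^sup>+x. f x \<partial>exp_prod (insert i I) p) =
      (\<integral>\<^sup>+x. \<integral>\<^sup>+y. f (x(i := y)) \<partial>exp_law (p i) \<partial>exp_prod I p)"
    and "(\<lambda>x. \<integral>\<^sup>+y. f (x(i := y)) \<partial>exp_law (p i)) \<in> borel_measurable (\<Pi>\<^sub>M i\<in>I. borel)"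
proof -
  interpret product_prob_space "\<lambda>i. exp_law (p i)"
    by (rule product_prob_space_exp_law) fact
  have f': "f \<in> borel_measurable (Pi\<^sub>M (insert i I) (\<lambda>i. exp_law (p i)))"
    using f measurable_cong_sets[OF sets_exp_prod[of "insert i I" p] refl]
    unfolding exp_prod_def by blast
  show "(\<integral>\<^sup>+x. f x \<partial>exp_prod (insert i I) p) =
      (\<integral>\<^sup>+x. \<integral>\<^sup>+y. f (x(i := y)) \<partial>exp_law (p i) \<partial>exp_prod I p)"
    unfolding exp_prod_def using assms(1,2) f' by (rule product_nn_integral_insert)
  have "(\<lambda>(x, y). f (x(i := y))) \<in> borel_measurable ((\<Pi>\<^sub>M i\<in>I. borel) \<Otimes>\<^sub>M exp_law (p i))"
    using measurable_compose[OF measurable_add_dim f]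
    by (simp add: case_prod_unfold cong: measurable_cong_sets)
  then show "(\<lambda>x. \<integral>\<^sup>+y. f (x(i := y)) \<partial>exp_law (p i)) \<in> borel_measurable (\<Pi>\<^sub>M i\<in>I. borel)"
    using sigma_finite_measure.borel_measurable_nn_integral[OF sigma_finite_measures] by blast
qed

text \<open>The sites \<open>q\<close>, \<open>r\<close>, \<open>s\<close> hold the variables
  \<open>z\<close>, \<open>w1\<close>, \<open>w2\<close> of Burke's map. All three new values are
  computed from the old \<open>w\<close>, so the assignment is simultaneous.\<close>

definition burke_update :: "'i \<Rightarrow> 'i \<Rightarrow> 'i \<Rightarrow> ('i \<Rightarrow> real) \<Rightarrow> 'i \<Rightarrow> real" where
  "burke_update q r s w =
     w(s := w s + max 0 (w r - w q), r := min (w q) (w r), q := w s + max 0 (w q - w r))"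

lemma measurable_fun_upd3:
  assumes "x \<in> measurable N (\<Pi>\<^sub>M i\<in>S. borel)" "a \<in> borel_measurable N" "b \<in> borel_measurable N"
    "c \<in> borel_measurable N"
  shows "(\<lambda>t. (x t)(s := a t, r := b t, q := c t))
    \<in> measurable N (\<Pi>\<^sub>M i\<in>insert q (insert r (insert s S)). borel)"
proof -
  have 1: "(\<lambda>t. (x t)(s := a t)) \<in> measurable N (\<Pi>\<^sub>M i\<in>insert s S. borel)"
    by (rule measurable_fun_upd[OF _ assms(1,2)]) simp
  have 2: "(\<lambda>t. (x t)(s := a t, r := b t)) \<in> measurable N (\<Pi>\<^sub>M i\<in>insert r (insert s S). borel)"
    by (rule measurable_fun_upd[OF _ 1 assms(3)]) simp
  show ?thesis
    by (rule measurable_fun_upd[OF _ 2 assms(4)]) simp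
qed

lemma measurable_burke_update:
  assumes "q \<in> S" "r \<in> S" "s \<in> S"
  shows "burke_update q r s \<in> measurable (\<Pi>\<^sub>M i\<in>S. borel) (\<Pi>\<^sub>M i\<in>S. borel)"
proof -
  have S: "insert q (insert r (insert s S)) = S" using assms by auto
  have comp: "(\<lambda>w. w i) \<in> borel_measurable (\<Pi>\<^sub>M i\<in>S. (borel :: real measure))" if "i \<in> S" for i
    using that by (rule measurable_component_singleton)
  have "(\<lambda>w :: _ \<Rightarrow> real. w(s := w s + max 0 (w r - w q), r := min (w q) (w r), q := w s + max 0 (w q - w r)))
    \<in> measurable (\<Pi>\<^sub>M i\<in>S. borel) (\<Pi>\<^sub>M i\<in>insert q (insert r (insert s S)). borel)"
    by (intro measurable_fun_upd3 measurable_ident_sets[OF refl] borel_measurable_add borel_measurable_max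
        borel_measurable_min borel_measurable_diff borel_measurable_const comp assms)
  then show ?thesis
    unfolding S burke_update_def[abs_def] .
qed

text \<open>With all other sites frozen, the integral over \<open>q\<close>, \<open>r\<close>,
  \<open>s\<close> is the one in \<open>burke_nn_integral\<close> with \<open>\<alpha> = p r\<close>
  and \<open>\<beta> = p q\<close>; indicator functions then give equality of measures. The rate at
  \<open>q\<close> is unchanged, so this site can be used again.\<close>

lemma distr_burke_update:
  assumes S: "finite S" "q \<in> S" "r \<in> S" "s \<in> S" "distinct [q, r, s]"
    and p: "\<And>i. 0 < p i" "p s = p r + p q"
  shows "distr (exp_prod S p) (\<Pi>\<^sub>M i\<in>S. borel) (burke_update q r s) =
    exp_prod S (p(r := p s, s := p r))"
proof (rule measure_eqI)
  fix A assume "A \<in> sets (distr (exp_prod S p) (\<Pi>\<^sub>M i\<in>S. borel) (burke_update q r s))"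
  then have A: "A \<in> sets (\<Pi>\<^sub>M i\<in>S. borel)" by simp
  define R where "R = S - {q, r, s}"
  have SR: "S = insert q (insert r (insert s R))" and R: "finite R"
    "s \<notin> R" "r \<notin> insert s R" "q \<notin> insert r (insert s R)"
    using S by (auto simp: R_def)
  \<comment> \<open>The order of insertion makes \<open>q\<close> the innermost and \<open>s\<close>
    the outermost of the three variables, as in \<open>burke_nn_integral\<close>. The rates
    \<open>p'\<close> are general because both the old and the new ones are needed.\<close>
  have expand: "(\<integral>\<^sup>+w. h w \<partial>exp_prod S p') = (\<integral>\<^sup>+w. \<integral>\<^sup>+v. \<integral>\<^sup>+y. \<integral>\<^sup>+x. h (w(s := v, r := y, q := x))
      \<partial>exp_law (p' q) \<partial>exp_law (p' r) \<partial>exp_law (p' s) \<partial>exp_prod R p')"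
    if "h \<in> borel_measurable (\<Pi>\<^sub>M i\<in>S. borel)" "\<And>i. 0 < p' i" for h p'
  proof -
    have fin: "finite (insert s R)" "finite (insert r (insert s R))" using R by auto
    note 1 = nn_integral_exp_prod_insert[OF fin(2) R(4) that(2) that(1)[unfolded SR]]
    note 2 = nn_integral_exp_prod_insert[OF fin(1) R(3) that(2) 1(2)]
    note 3 = nn_integral_exp_prod_insert[OF R(1,2) that(2) 2(2)]
    show ?thesis unfolding SR by (rule trans[OF 1(1) trans[OF 2(1) 3(1)]])
  qed
  define g where "g = (indicator A :: _ \<Rightarrow> ennreal)"
  have g: "g \<in> borel_measurable (\<Pi>\<^sub>M i\<in>S. borel)" using A by (simp add: g_def)
  let ?p = "p(r := p s, s := p r)"
  note T = measurable_burke_update[OF S(2-4)]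
  have "emeasure (distr (exp_prod S p) (\<Pi>\<^sub>M i\<in>S. borel) (burke_update q r s)) A =
    (\<integral>\<^sup>+w. g w \<partial>distr (exp_prod S p) (\<Pi>\<^sub>M i\<in>S. borel) (burke_update q r s))"
    using A by (simp add: g_def)
  also have "\<dots> = (\<integral>\<^sup>+w. g (burke_update q r s w) \<partial>exp_prod S p)"
    by (rule nn_integral_distr) (simp_all only: T g measurable_distr_eq1 measurable_cong_sets[OF sets_exp_prod refl])
  also have "\<dots> = (\<integral>\<^sup>+w. \<integral>\<^sup>+v. \<integral>\<^sup>+y. \<integral>\<^sup>+x. g (w(s := v + max 0 (y - x), r := min x y, q := v + max 0 (x - y)))
      \<partial>exp_law (p q) \<partial>exp_law (p r) \<partial>exp_law (p s) \<partial>exp_prod R p)"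
  proof -
    have "burke_update q r s (w(s := v, r := y, q := x)) =
        w(s := v + max 0 (y - x), r := min x y, q := v + max 0 (x - y))" for w v y x
      using S(5) by (auto simp: burke_update_def fun_eq_iff)
    then show ?thesis
      by (subst expand[OF measurable_compose[OF T g] p(1)]) simp
  qed
  also have "\<dots> = (\<integral>\<^sup>+w. \<integral>\<^sup>+v. \<integral>\<^sup>+y. \<integral>\<^sup>+x. g (w(s := v, r := y, q := x))
      \<partial>exp_law (?p q) \<partial>exp_law (?p r) \<partial>exp_law (?p s) \<partial>exp_prod R p)"
  proof (intro nn_integral_cong)
    fix w assume "w \<in> space (exp_prod R p)"
    then have w: "w \<in> space (\<Pi>\<^sub>M i\<in>R. (borel :: real measure))" by (simp add: space_exp_prod)
    have "(\<lambda>(x, y, v). w(s := v, r := y, q := x))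
        \<in> measurable (borel \<Otimes>\<^sub>M borel \<Otimes>\<^sub>M borel) (\<Pi>\<^sub>M i\<in>S. borel)"
      unfolding SR case_prod_unfold using w by (intro measurable_fun_upd3) simp_all
    from measurable_compose[OF this g]
    have "(\<lambda>(x, y, v). g (w(s := v, r := y, q := x)))
        \<in> borel_measurable (borel \<Otimes>\<^sub>M borel \<Otimes>\<^sub>M borel)"
      by (simp add: case_prod_unfold)
    from burke_nn_integral[OF this p(1)[of r] p(1)[of q]]
    show "(\<integral>\<^sup>+v. \<integral>\<^sup>+y. \<integral>\<^sup>+x. g (w(s := v + max 0 (y - x), r := min x y, q := v + max 0 (x - y)))
          \<partial>exp_law (p q) \<partial>exp_law (p r) \<partial>exp_law (p s)) =
        (\<integral>\<^sup>+v. \<integral>\<^sup>+y. \<integral>\<^sup>+x. g (w(s := v, r := y, q := x))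
          \<partial>exp_law (?p q) \<partial>exp_law (?p r) \<partial>exp_law (?p s))"
      using S(5) p(2) by simp
  qed
  also have "exp_prod R p = exp_prod R ?p"
    using R by (intro exp_prod_cong) auto
  also have "(\<integral>\<^sup>+w. \<integral>\<^sup>+v. \<integral>\<^sup>+y. \<integral>\<^sup>+x. g (w(s := v, r := y, q := x))
      \<partial>exp_law (?p q) \<partial>exp_law (?p r) \<partial>exp_law (?p s) \<partial>exp_prod R ?p) = (\<integral>\<^sup>+w. g w \<partial>exp_prod S ?p)"
    by (rule expand[OF g, symmetric]) (use p(1) in simp)
  also have "\<dots> = emeasure (exp_prod S ?p) A"
    using A by (simp add: g_def sets_exp_prod)
  finally show "emeasure (distr (exp_prod S p) (\<Pi>\<^sub>M i\<in>S. borel) (burke_update q r s)) A =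
    emeasure (exp_prod S ?p) A" .
qed (simp add: sets_exp_prod)

section \<open>Laws of finitely many last-passage times\<close>

text \<open>The order conditions rule out maxima over empty path sets; with the inclusion, the times
  indexed by \<open>J\<close> depend only on the weights in \<open>S\<close>.\<close>

definition covers :: "(int \<times> int) set \<Rightarrow> ((int \<times> int) \<times> (int \<times> int)) set \<Rightarrow> bool" where
  "covers S J \<longleftrightarrow> (\<forall>(u, v)\<in>J. fst u \<le> fst v \<and> snd u \<le> snd v \<and>
     {fst u..fst v} \<times> {snd u..snd v} \<subseteq> S)"

abbreviation rates :: "(int \<Rightarrow> real) \<Rightarrow> (int \<Rightarrow> real) \<Rightarrow> int \<times> int \<Rightarrow> real" where
  "rates a b \<equiv> \<lambda>(i, j). a i + b j"

definition lpp_law ::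
    "(int \<times> int) set \<Rightarrow> (int \<times> int \<Rightarrow> real) \<Rightarrow> ((int \<times> int) \<times> (int \<times> int)) set \<Rightarrow>
     ((int \<times> int) \<times> (int \<times> int) \<Rightarrow> real) measure" where
  "lpp_law S p J = joint_law (exp_prod S p) J (\<lambda>(x, y). last_passage x y)"

lemma covers_mono: "covers S J \<Longrightarrow> S \<subseteq> S' \<Longrightarrow> covers S' J"
  unfolding covers_def by fastforce

lemma last_passage_restrict:
  assumes "covers S J" "i \<in> J"
  shows "(case i of (x, y) \<Rightarrow> last_passage x y) (restrict w S) =
    (case i of (x, y) \<Rightarrow> last_passage x y) w"
proof -
  obtain u v where Pair: "i = (u, v)" by (cases i)
  then have "{fst u..fst v} \<times> {snd u..snd v} \<subseteq> S" using assms by (auto simp: covers_def)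
  then show ?thesis unfolding Pair by (auto intro!: last_passage_cong)
qed

lemma measurable_last_passage_family:
  assumes "covers S J"
  shows "(\<lambda>w. \<lambda>i\<in>J. (case i of (x, y) \<Rightarrow> last_passage x y) w)
    \<in> measurable (\<Pi>\<^sub>M i\<in>S. borel) (\<Pi>\<^sub>M i\<in>J. borel)"
proof (rule measurable_restrict)
  fix i assume i: "i \<in> J"
  obtain u v where uv: "i = (u, v)" by (cases i)
  then have le: "fst u \<le> fst v" "snd u \<le> snd v" using assms i by (auto simp: covers_def)
  \<comment> \<open>\<open>measurable_last_passage\<close> asks for measurability at every site;
    after restriction a site outside \<open>S\<close> contributes the constant
    \<open>undefined\<close>.\<close>
  have comp: "(\<lambda>w. restrict w S p) \<in> borel_measurable (\<Pi>\<^sub>M i\<in>S. borel)" for p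
    by (cases "p \<in> S") simp_all
  have "(\<lambda>w. last_passage u v (restrict w S)) \<in> borel_measurable (\<Pi>\<^sub>M i\<in>S. borel)"
    using comp le by (rule measurable_last_passage)
  then show "(\<lambda>w. (case i of (x, y) \<Rightarrow> last_passage x y) w) \<in> borel_measurable (\<Pi>\<^sub>M i\<in>S. borel)"
    using last_passage_restrict[OF assms i] unfolding uv by simp
qed

text \<open>A coupling argument: \<open>T\<close> realises the weights of the second law as a
  function of those of the first without altering any of the times.\<close>

lemma lpp_law_eqI:
  assumes T: "T \<in> measurable (\<Pi>\<^sub>M i\<in>S. borel) (\<Pi>\<^sub>M i\<in>S'. borel)"
    and d: "distr (exp_prod S p) (\<Pi>\<^sub>M i\<in>S'. borel) T = exp_prod S' p'"
    and "covers S' J"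
    and inv: "\<And>w u v. (u, v) \<in> J \<Longrightarrow> last_passage u v (T w) = last_passage u v w"
  shows "lpp_law S p J = lpp_law S' p' J"
proof -
  have "lpp_law S' p' J = distr (exp_prod S p) (\<Pi>\<^sub>M i\<in>J. borel)
      ((\<lambda>w. \<lambda>i\<in>J. (case i of (x, y) \<Rightarrow> last_passage x y) w) \<circ> T)"
    unfolding lpp_law_def joint_law_def d[symmetric]
    using measurable_last_passage_family[OF assms(3)] T
    by (intro distr_distr) (simp_all only: measurable_cong_sets[OF sets_exp_prod refl])
  also have "\<dots> = lpp_law S p J"
    unfolding lpp_law_def joint_law_def
    by (intro distr_cong refl) (auto simp: fun_eq_iff restrict_def inv)
  finally show ?thesis ..
qed

text \<open>The times read only sites in \<open>S'\<close>, and the marginal of a product law is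
  again a product. Used in both directions, to bring in auxiliary sites and to drop them
  again.\<close>

lemma lpp_law_restrict:
  assumes "finite S" "S' \<subseteq> S" "covers S' J" "\<And>i. 0 < p i" "\<And>i. i \<in> S' \<Longrightarrow> p i = p' i"
  shows "lpp_law S p J = lpp_law S' p' J"
proof (rule lpp_law_eqI)
  show "(\<lambda>w. restrict w S') \<in> measurable (\<Pi>\<^sub>M i\<in>S. borel) (\<Pi>\<^sub>M i\<in>S'. (borel :: real measure))"
    using assms(2) by (rule measurable_restrict_subset)
  show "distr (exp_prod S p) (\<Pi>\<^sub>M i\<in>S'. borel) (\<lambda>w. restrict w S') = exp_prod S' p'"
    using exp_prod_restrict[where p = p, OF assms(1,2,4)] exp_prod_cong[of S' p p'] assms(5) by simp
  show "last_passage u v (restrict w S') = last_passage u v w" if "(u, v) \<in> J" for u v w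
    using last_passage_restrict[OF assms(3) that] by simp
qed fact

text \<open>By independence the weights on \<open>S\<close> have law
  \<open>exp_prod S (rates a b)\<close>, so the given probability space can be replaced by a finite
  product.\<close>

lemma joint_law_exp_weights:
  assumes "exp_weights M a b \<omega>" "finite S" "S \<noteq> {}" "covers S J"
  shows "joint_law M J (\<lambda>(x, y) s. last_passage x y (\<lambda>p. \<omega> p s)) = lpp_law S (rates a b) J"
proof -
  interpret prob_space M using assms(1) by (simp add: exp_weights_def)
  have rv: "\<omega> p \<in> borel_measurable M" for p
    using assms(1) unfolding exp_weights_def indep_vars_def by blast
  have law: "distr M borel (\<omega> p) = exp_law (rates a b p)" for p
  proof -
    have "distributed M lborel (\<omega> p) (exponential_density (rates a b p))"
      using assms(1) by (cases p) (simp add: exp_weights_def)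
    then have "distr M lborel (\<omega> p) = exp_law (rates a b p)" by (simp add: distributed_def)
    moreover have "distr M lborel (\<omega> p) = distr M borel (\<omega> p)" by (rule distr_cong) simp_all
    ultimately show ?thesis by simp
  qed
  have "indep_vars (\<lambda>_. borel) \<omega> S"
    using assms(1) indep_vars_subset unfolding exp_weights_def by blast
  then have "distr M (\<Pi>\<^sub>M i\<in>S. borel) (\<lambda>s. \<lambda>p\<in>S. \<omega> p s) = exp_prod S (rates a b)"
    using rv assms(3) unfolding exp_prod_def
    by (subst (asm) indep_vars_iff_distr_eq_PiM) (simp_all add: law)
  then have "lpp_law S (rates a b) J =
      joint_law (distr M (\<Pi>\<^sub>M i\<in>S. borel) (\<lambda>s. \<lambda>p\<in>S. \<omega> p s)) J (\<lambda>(x, y). last_passage x y)"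
    by (simp add: lpp_law_def)
  also have "\<dots> = distr M (\<Pi>\<^sub>M i\<in>J. borel)
      ((\<lambda>w. \<lambda>i\<in>J. (case i of (x, y) \<Rightarrow> last_passage x y) w) \<circ> (\<lambda>s. \<lambda>p\<in>S. \<omega> p s))"
    unfolding joint_law_def
    by (intro distr_distr measurable_last_passage_family measurable_restrict rv assms)
  also have "\<dots> = joint_law M J (\<lambda>(x, y) s. last_passage x y (\<lambda>p. \<omega> p s))"
  proof -
    have "(case i of (x, y) \<Rightarrow> last_passage x y) (\<lambda>p\<in>S. \<omega> p s) =
        (case i of (x, y) \<Rightarrow> \<lambda>s. last_passage x y (\<lambda>p. \<omega> p s)) s" if "i \<in> J" for i s
      using last_passage_restrict[OF assms(4) that, of "\<lambda>p. \<omega> p s"] by (simp add: case_prod_unfold)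
    then show ?thesis unfolding joint_law_def
      by (intro distr_cong refl) (auto simp: fun_eq_iff restrict_def)
  qed
  finally show ?thesis ..
qed

section \<open>Iteration of Burke's map over the rows and exchange of two columns\<close>

text \<open>The unused site \<open>(k, m - 1)\<close> below the rows under consideration stores the carried variable.\<close>
primrec burke_rows :: "int \<Rightarrow> int \<Rightarrow> nat \<Rightarrow> (int \<times> int \<Rightarrow> real) \<Rightarrow> int \<times> int \<Rightarrow> real" where
  "burke_rows k m 0 w = w"
| "burke_rows k m (Suc l) w =
     burke_update (k, m - 1) (k, m + int l) (k + 1, m + int l) (burke_rows k m l w)"

lemma burke_rows_above:
  "m + int l \<le> j \<Longrightarrow> burke_rows k m l w (i, j) = w (i, j)"
  by (induction l) (auto simp: burke_update_def)

lemma burke_rows_outside: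
  "i \<noteq> k \<Longrightarrow> i \<noteq> k + 1 \<Longrightarrow> burke_rows k m l w (i, j) = w (i, j)"
  by (induction l) (auto simp: burke_update_def)

text \<open>An update touches only its own row and the storage site in row \<open>m - 1\<close>, so
  a processed row keeps its values.\<close>

lemma burke_rows_stable:
  "l' < l \<Longrightarrow> burke_rows k m l w (i, m + int l') = burke_rows k m (Suc l') w (i, m + int l')"
proof (induction l)
  case (Suc l)
  show ?case
  proof (cases "l = l'")
    case False
    then have "burke_rows k m l w (i, m + int l') = burke_rows k m (Suc l') w (i, m + int l')"
      using Suc by simp
    then show ?thesis using False by (simp add: burke_update_def)
  qed simp
qed simp

lemma last_passage_burke_rows:
  assumes "x1 \<le> y1" "x2 \<le> y2" "x1 \<noteq> k + 1" "y1 \<noteq> k" "m \<le> x2" "y2 < m + int l"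
  shows "last_passage (x1, x2) (y1, y2) (burke_rows k m l w) = last_passage (x1, x2) (y1, y2) w"
proof -
  \<comment> \<open>\<open>z j\<close> is the content of the storage site after rows
    \<open>m\<close> to \<open>j\<close>, that is after \<open>j - m + 1\<close> updates;
    \<open>z (m - 1)\<close> is its initial value.\<close>
  define z where "z = (\<lambda>j. burke_rows k m (nat (j - m + 1)) w (k, m - 1))"
  have row: "burke_rows k m l w (k, j) = min (z (j - 1)) (w (k, j)) \<and>
      burke_rows k m l w (k + 1, j) = w (k + 1, j) + max 0 (w (k, j) - z (j - 1)) \<and>
      z j = w (k + 1, j) + max 0 (z (j - 1) - w (k, j))" if "m \<le> j" "j < m + int l" for j
  proof -
    define l' where "l' = nat (j - m)"
    have j: "j = m + int l'" "l' < l" using that by (auto simp: l'_def)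
    have z: "z (j - 1) = burke_rows k m l' w (k, m - 1)"
      "z j = burke_rows k m (Suc l') w (k, m - 1)"
      by (simp_all add: z_def j nat_add_distrib)
    show ?thesis
      unfolding j(1) burke_rows_stable[OF j(2)] z[unfolded j(1)]
      using burke_rows_above[of m l' "m + int l'" k w] by (simp add: burke_update_def)
  qed
  show ?thesis
    by (rule burke_last_passage[where k = k and m = m and n = "m + int l - 1" and z = z])
      (use assms row in \<open>auto simp: burke_rows_outside\<close>)
qed

definition swap_columns :: "int \<Rightarrow> int \<Rightarrow> nat \<Rightarrow> (int \<times> int \<Rightarrow> real) \<Rightarrow> int \<times> int \<Rightarrow> real" where
  "swap_columns k m l p = (\<lambda>(i, j).
     if m \<le> j \<and> j < m + int l then p (Transposition.transpose k (k + 1) i, j) else p (i, j))"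

text \<open>After each row the storage site again has its original rate and is independent of the
  other sites, so \<open>distr_burke_update\<close> applies to the next row. This rests on the rate
  difference between the two columns being the same in every row.\<close>

lemma distr_burke_rows:
  assumes S: "finite S" "(k, m - 1) \<in> S"
      "\<And>i j. i \<in> {k, k + 1} \<Longrightarrow> m \<le> j \<Longrightarrow> j < m + int l \<Longrightarrow> (i, j) \<in> S"
    and p: "\<And>i. 0 < p i" "\<And>j. m \<le> j \<Longrightarrow> j < m + int l \<Longrightarrow> p (k + 1, j) = p (k, j) + p (k, m - 1)"
  shows "burke_rows k m l \<in> measurable (\<Pi>\<^sub>M i\<in>S. borel) (\<Pi>\<^sub>M i\<in>S. borel) \<and>
    distr (exp_prod S p) (\<Pi>\<^sub>M i\<in>S. borel) (burke_rows k m l) = exp_prod S (swap_columns k m l p)"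
  using S(3) p(2)
proof (induction l)
  case 0
  have "burke_rows k m 0 = (\<lambda>w. w)" "swap_columns k m 0 p = p"
    by (auto simp: fun_eq_iff swap_columns_def)
  moreover have "distr (exp_prod S p) (\<Pi>\<^sub>M i\<in>S. borel) (\<lambda>w. w) = exp_prod S p"
    by (rule distr_id2) (simp add: sets_exp_prod)
  ultimately show ?case by (simp add: measurable_ident_sets)
next
  case (Suc l)
  let ?q = "(k, m - 1)" and ?r = "(k, m + int l)" and ?s = "(k + 1, m + int l)"
  let ?p = "swap_columns k m l p"
  have IH: "burke_rows k m l \<in> measurable (\<Pi>\<^sub>M i\<in>S. borel) (\<Pi>\<^sub>M i\<in>S. borel)"
    "distr (exp_prod S p) (\<Pi>\<^sub>M i\<in>S. borel) (burke_rows k m l) = exp_prod S ?p"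
    using Suc by auto
  have sites: "?q \<in> S" "?r \<in> S" "?s \<in> S" "distinct [?q, ?r, ?s]"
    using S(2) Suc.prems(1) by auto
  have comp: "burke_rows k m (Suc l) = burke_update ?q ?r ?s \<circ> burke_rows k m l" by auto
  \<comment> \<open>In \<open>?p\<close> only the first \<open>l\<close> rows are exchanged; row
    \<open>m + int l\<close> still has its original rates.\<close>
  have p': "?p ?s = ?p ?r + ?p ?q" "\<And>i. 0 < ?p i"
    using Suc.prems(2)[of "m + int l"] p(1) by (auto simp: swap_columns_def)
  have "distr (exp_prod S p) (\<Pi>\<^sub>M i\<in>S. borel) (burke_rows k m (Suc l)) =
      distr (distr (exp_prod S p) (\<Pi>\<^sub>M i\<in>S. borel) (burke_rows k m l)) (\<Pi>\<^sub>M i\<in>S. borel)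
        (burke_update ?q ?r ?s)"
    unfolding comp using measurable_burke_update[OF sites(1-3)] IH(1)
    by (intro distr_distr[symmetric]) (simp_all only: measurable_cong_sets[OF sets_exp_prod refl])
  also have "\<dots> = exp_prod S (?p(?r := ?p ?s, ?s := ?p ?r))"
    unfolding IH(2) using S(1) sites p'(2,1) by (rule distr_burke_update)
  also have "?p(?r := ?p ?s, ?s := ?p ?r) = swap_columns k m (Suc l) p"
    by (auto simp: fun_eq_iff swap_columns_def Transposition.transpose_def)
  finally show ?case
    using measurable_comp[OF IH(1) measurable_burke_update[OF sites(1-3)]] by (simp only: comp)
qed

text \<open>The strict inequality makes \<open>a (k + 1) - a k\<close> a valid rate for the carried
  variable. Auxiliary sites are added, \<open>burke_rows\<close> exchanges the two columns, and the
  auxiliary sites are discarded.\<close>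

lemma lpp_law_transpose_less:
  fixes a b :: "int \<Rightarrow> real"
  assumes S: "finite S" "covers S J" and pos: "\<And>i j. 0 < a i + b j" and less: "a k < a (k + 1)"
    and J: "\<And>u v. (u, v) \<in> J \<Longrightarrow> fst u \<noteq> k + 1 \<and> fst v \<noteq> k"
  shows "lpp_law S (rates a b) J = lpp_law S (rates (a \<circ> Transposition.transpose k (k + 1)) b) J"
proof -
  \<comment> \<open>Row 0 is added so that \<open>m \<le> n\<close> holds even for empty
    \<open>S\<close>.\<close>
  have "finite (insert 0 (snd ` S))" using S(1) by simp
  then obtain m n where mn: "insert 0 (snd ` S) \<subseteq> {m..n}"
    by (metis Max_ge Min_le atLeastAtMost_iff subsetI)
  define l where "l = nat (n - m + 1)"
  have l: "m + int l = n + 1" using mn by (auto simp: l_def)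
  have rows: "m \<le> j \<and> j < m + int l" if "(i, j) \<in> S" for i j
    using mn that unfolding l by force
  \<comment> \<open>Both columns are completed over rows \<open>m\<close> to \<open>n\<close>, since
    every update needs its pair of weights. The storage site \<open>(k, m - 1)\<close> lies below
    all rows of \<open>S\<close>, so giving it a rate of its own does not affect
    \<open>S\<close>.\<close>
  define T where "T = insert (k, m - 1) (S \<union> {k, k + 1} \<times> {m..n})"
  have T: "finite T" "S \<subseteq> T" "covers T J"
    using S covers_mono[OF S(2), of T] by (auto simp: T_def)
  define p where "p = (rates a b)((k, m - 1) := a (k + 1) - a k)"
  have p: "0 < p i" "0 < swap_columns k m l p i" for i
    using pos less by (auto simp: p_def swap_columns_def split: prod.splits)
  have p_eq: "p (i, j) = a i + b j" if "m \<le> j" for i j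
    using that by (simp add: p_def)
  have p_S: "p i = rates a b i" if "i \<in> S" for i
    using rows that p_eq by (cases i) auto
  have p'_S: "swap_columns k m l p i = rates (a \<circ> Transposition.transpose k (k + 1)) b i"
    if "i \<in> S" for i
    using rows that p_eq by (cases i) (simp add: swap_columns_def)
  have "lpp_law S (rates a b) J = lpp_law T p J"
    by (rule lpp_law_restrict[symmetric]) (use S T p p_S in auto)
  also have "\<dots> = lpp_law T (swap_columns k m l p) J"
  proof (rule lpp_law_eqI)
    have *: "burke_rows k m l \<in> measurable (\<Pi>\<^sub>M i\<in>T. borel) (\<Pi>\<^sub>M i\<in>T. borel) \<and>
      distr (exp_prod T p) (\<Pi>\<^sub>M i\<in>T. borel) (burke_rows k m l) = exp_prod T (swap_columns k m l p)"
      by (rule distr_burke_rows) (use T(1) p l in \<open>auto simp: T_def p_def\<close>)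
    then show "burke_rows k m l \<in> measurable (\<Pi>\<^sub>M i\<in>T. borel) (\<Pi>\<^sub>M i\<in>T. borel)"
      "distr (exp_prod T p) (\<Pi>\<^sub>M i\<in>T. borel) (burke_rows k m l) = exp_prod T (swap_columns k m l p)"
      by blast+
    show "last_passage u v (burke_rows k m l w) = last_passage u v w" if "(u, v) \<in> J" for u v w
    proof -
      have uv: "fst u \<le> fst v" "snd u \<le> snd v" "{fst u..fst v} \<times> {snd u..snd v} \<subseteq> S"
        using S(2) that by (auto simp: covers_def)
      have "(fst u, snd u) \<in> S" "(fst v, snd v) \<in> S"
        by (rule subsetD[OF uv(3)], use uv(1,2) in \<open>simp add: mem_Times_iff\<close>)+
      then show ?thesis
        using last_passage_burke_rows[of "fst u" "fst v" "snd u" "snd v" k m l w] uv rows J[OF that]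
        by force
    qed
  qed fact
  also have "\<dots> = lpp_law S (rates (a \<circ> Transposition.transpose k (k + 1)) b) J"
    by (rule lpp_law_restrict) (use S T p p'_S in auto)
  finally show ?thesis .
qed

lemma lpp_law_transpose:
  fixes a b :: "int \<Rightarrow> real"
  assumes "finite S" "covers S J" and pos: "\<And>i j. 0 < a i + b j"
    and "\<And>u v. (u, v) \<in> J \<Longrightarrow> fst u \<noteq> k + 1 \<and> fst v \<noteq> k"
  shows "lpp_law S (rates a b) J = lpp_law S (rates (a \<circ> Transposition.transpose k (k + 1)) b) J"
proof (cases "a k" "a (k + 1)" rule: linorder_cases)
  case less
  with assms show ?thesis by (intro lpp_law_transpose_less)
next
  case equal
  then have "a \<circ> Transposition.transpose k (k + 1) = a"
    by (auto simp: fun_eq_iff Transposition.transpose_def)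
  then show ?thesis by simp
next
  case greater
  \<comment> \<open>The exchanged sequence increases at \<open>k\<close>, and exchanging twice gives
    \<open>a\<close> back.\<close>
  let ?a = "a \<circ> Transposition.transpose k (k + 1)"
  have "lpp_law S (rates ?a b) J = lpp_law S (rates (?a \<circ> Transposition.transpose k (k + 1)) b) J"
    by (rule lpp_law_transpose_less) (use assms greater in auto)
  then show ?thesis by (simp add: comp_assoc)
qed

section \<open>Permutations of rows and columns\<close>

text \<open>Without a descent \<open>\<sigma>\<close> increases strictly on the interval; induction
  from the lower end gives \<open>i \<le> \<sigma> i\<close>, and from the upper end
  \<open>\<sigma> i \<le> i\<close>.\<close>

lemma permutes_atLeastAtMost_descent:
  fixes \<sigma> :: "int \<Rightarrow> int"
  assumes "\<sigma> permutes {lo..hi}" "\<sigma> \<noteq> id"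
  obtains k where "lo \<le> k" "k + 1 \<le> hi" "\<sigma> (k + 1) < \<sigma> k"
proof -
  have "\<exists>k. lo \<le> k \<and> k + 1 \<le> hi \<and> \<sigma> (k + 1) < \<sigma> k"
  proof (rule ccontr)
    assume no: "\<not> ?thesis"
    have in_range: "lo \<le> \<sigma> i \<and> \<sigma> i \<le> hi" if "lo \<le> i" "i \<le> hi" for i
      using permutes_in_image[OF assms(1), of i] that by simp
    have inc: "\<sigma> k < \<sigma> (k + 1)" if "lo \<le> k" "k + 1 \<le> hi" for k
      using no that permutes_inj[OF assms(1)] by (metis inj_eq linorder_neqE less_irrefl zless_add1_eq)
    have up: "i \<le> \<sigma> i" if "lo \<le> i" "i \<le> hi" for i
      using that
    proof (induction i rule: int_ge_induct)
      case base
      then show ?case using in_range by simp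
    next
      case (step i)
      then show ?case using inc[of i] by simp
    qed
    have down: "\<sigma> i \<le> i" if "i \<le> hi" "lo \<le> i" for i
      using that
    proof (induction i rule: int_le_induct)
      case base
      then show ?case using in_range by simp
    next
      case (step i)
      then show ?case using inc[of "i - 1"] by simp
    qed
    have "\<sigma> i = i" for i
      using up[of i] down[of i] permutes_not_in[OF assms(1), of i] by fastforce
    with assms(2) show False by auto
  qed
  then show thesis using that by blast
qed

text \<open>Induction on the squared displacement: removing a descent at \<open>k\<close> lowers it
  by \<open>2 * (\<sigma> k - \<sigma> (k + 1))\<close>, which is positive. One adjacent exchange
  leads from the resulting permutation back to \<open>\<sigma>\<close>.\<close>

lemma lpp_law_permute_columns:
  fixes a b :: "int \<Rightarrow> real"
  assumes "finite S" "covers S J" "\<And>i j. 0 < a i + b j" "\<sigma> permutes {lo..hi}"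
    and "\<And>u v. (u, v) \<in> J \<Longrightarrow> \<sigma> ` {..<fst u} = {..<fst u} \<and> \<sigma> ` {fst v<..} = {fst v<..}"
  shows "lpp_law S (rates a b) J = lpp_law S (rates (a \<circ> \<sigma>) b) J"
  using assms(4,5)
proof (induction "nat (\<Sum>i\<in>{lo..hi}. (\<sigma> i - i)\<^sup>2)" arbitrary: \<sigma> rule: less_induct)
  case less
  show ?case
  proof (cases "\<sigma> = id")
    case False
    then obtain k where k: "lo \<le> k" "k + 1 \<le> hi" "\<sigma> (k + 1) < \<sigma> k"
      using permutes_atLeastAtMost_descent[OF less.prems(1)] by blast
    let ?t = "Transposition.transpose k (k + 1)"
    have t: "?t permutes {lo..hi}" using k by (intro permutes_swap_id) auto
    then have perm: "\<sigma> \<circ> ?t permutes {lo..hi}" using less.prems(1) by (rule permutes_compose)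
    have inj: "inj \<sigma>" using less.prems(1) by (rule permutes_inj)
    \<comment> \<open>A cut between \<open>k\<close> and \<open>k + 1\<close> that
      \<open>\<sigma>\<close> preserves would force
      \<open>\<sigma> k < \<sigma> (k + 1)\<close>.\<close>
    have cut: "fst u \<noteq> k + 1 \<and> fst v \<noteq> k" if "(u, v) \<in> J" for u v
    proof -
      have "\<sigma> x < fst u \<longleftrightarrow> x < fst u" "fst v < \<sigma> x \<longleftrightarrow> fst v < x" for x
        using less.prems(2)[OF that] inj_image_mem_iff[OF inj, of x "{..<fst u}"]
          inj_image_mem_iff[OF inj, of x "{fst v<..}"] by auto
      from this(1)[of k] this(1)[of "k + 1"] this(2)[of k] this(2)[of "k + 1"]
      show ?thesis using k(3) by auto
    qed
    have "(\<sigma> \<circ> ?t) ` {..<fst u} = {..<fst u} \<and> (\<sigma> \<circ> ?t) ` {fst v<..} = {fst v<..}"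
      if "(u, v) \<in> J" for u v
    proof -
      \<comment> \<open>With no cut between \<open>k\<close> and \<open>k + 1\<close>, each
        half-line contains both or neither of them and is preserved by \<open>?t\<close>.\<close>
      have "k < fst u \<longleftrightarrow> k + 1 < fst u" "fst v < k \<longleftrightarrow> fst v < k + 1"
        using cut[OF that] by auto
      then have "?t ` {..<fst u} = {..<fst u}" "?t ` {fst v<..} = {fst v<..}"
        by (simp_all add: transpose_image_eq)
      then show ?thesis using less.prems(2)[OF that] by (simp only: image_comp[symmetric])
    qed
    moreover have "(\<Sum>i\<in>{lo..hi}. ((\<sigma> \<circ> ?t) i - i)\<^sup>2) < (\<Sum>i\<in>{lo..hi}. (\<sigma> i - i)\<^sup>2)"
    proof -
      have "{k, k + 1} \<subseteq> {lo..hi}" using k by auto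
      then have split: "(\<Sum>i\<in>{lo..hi}. g i) = (\<Sum>i\<in>{lo..hi} - {k, k + 1}. g i) + (g k + g (k + 1))"
        for g :: "int \<Rightarrow> int"
        by (subst sum.subset_diff[of "{k, k + 1}"]) auto
      have same: "(\<Sum>i\<in>{lo..hi} - {k, k + 1}. ((\<sigma> \<circ> ?t) i - i)\<^sup>2) =
          (\<Sum>i\<in>{lo..hi} - {k, k + 1}. (\<sigma> i - i)\<^sup>2)"
        by (intro sum.cong) (auto simp: Transposition.transpose_def)
      show ?thesis
        unfolding split same using k(3) by (simp add: power2_eq_square algebra_simps)
    qed
    moreover have "0 \<le> (\<Sum>i\<in>{lo..hi}. ((\<sigma> \<circ> ?t) i - i)\<^sup>2)" by (intro sum_nonneg) simp
    ultimately have "lpp_law S (rates a b) J = lpp_law S (rates (a \<circ> (\<sigma> \<circ> ?t)) b) J"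
      using perm by (intro less.hyps) auto
    also have "\<dots> = lpp_law S (rates (a \<circ> (\<sigma> \<circ> ?t) \<circ> ?t) b) J"
      using assms(1-3) cut by (intro lpp_law_transpose) auto
    also have "a \<circ> (\<sigma> \<circ> ?t) \<circ> ?t = a \<circ> \<sigma>" by (simp add: comp_assoc)
    finally show ?thesis .
  qed simp
qed

section \<open>Reflection in the diagonal, from columns to rows\<close>

lemma covers_swap:
  assumes "covers S J"
  shows "covers (prod.swap ` S) (map_prod prod.swap prod.swap ` J)"
proof -
  have sub: "fst u \<le> fst v \<and> snd u \<le> snd v \<and> {fst u..fst v} \<times> {snd u..snd v} \<subseteq> S"
    if "(u, v) \<in> J" for u v
    using assms that by (auto simp: covers_def)
  have swapped: "{snd u..snd v} \<times> {fst u..fst v} \<subseteq> prod.swap ` S" if "(u, v) \<in> J" for u v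
  proof -
    have "prod.swap ` ({fst u..fst v} \<times> {snd u..snd v}) \<subseteq> prod.swap ` S"
      using sub[OF that] by (intro image_mono) simp
    then show ?thesis by (simp only: product_swap)
  qed
  show ?thesis
    unfolding covers_def
  proof (rule ballI)
    fix i assume "i \<in> map_prod prod.swap prod.swap ` J"
    then obtain u v where "(u, v) \<in> J" "i = (prod.swap u, prod.swap v)" by force
    then show "case i of (u, v) \<Rightarrow> fst u \<le> fst v \<and> snd u \<le> snd v \<and>
        {fst u..fst v} \<times> {snd u..snd v} \<subseteq> prod.swap ` S"
      using sub[of u v] swapped[of u v] by simp
  qed
qed

text \<open>Reflecting the weights exchanges the roles of \<open>a\<close> and \<open>b\<close> and
  reflects every rectangle. The outer map only renames the indices back to \<open>J\<close>.\<close>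

lemma lpp_law_swap:
  fixes a b :: "int \<Rightarrow> real"
  assumes S: "finite S" "covers S J" and pos: "\<And>i j. 0 < a i + b j"
  shows "lpp_law S (rates a b) J =
    distr (lpp_law (prod.swap ` S) (rates b a) (map_prod prod.swap prod.swap ` J))
      (\<Pi>\<^sub>M i\<in>J. borel) (\<lambda>g. \<lambda>i\<in>J. g (map_prod prod.swap prod.swap i))"
proof -
  let ?S = "prod.swap ` S" and ?J = "map_prod prod.swap prod.swap ` J"
  let ?\<rho> = "\<lambda>w. \<lambda>n\<in>S. w (prod.swap n)" and ?\<Psi> = "\<lambda>g. \<lambda>i\<in>J. g (map_prod prod.swap prod.swap i)"
  let ?L = "\<lambda>J w. \<lambda>i\<in>J. (case i of (x, y) \<Rightarrow> last_passage x y) w"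
  have covers: "covers ?S ?J"
    using S(2) by (rule covers_swap)
  have \<rho>: "?\<rho> \<in> measurable (\<Pi>\<^sub>M i\<in>?S. borel) (\<Pi>\<^sub>M i\<in>S. (borel :: real measure))"
    by (intro measurable_restrict measurable_component_singleton) auto
  have "distr (exp_prod ?S (rates b a)) (\<Pi>\<^sub>M n\<in>S. exp_law (rates b a (prod.swap n))) ?\<rho> =
      (\<Pi>\<^sub>M n\<in>S. exp_law (rates b a (prod.swap n)))"
    unfolding exp_prod_def
    by (rule distr_PiM_reindex)
      (use pos in \<open>auto simp: add.commute intro!: prob_space_exponential_density\<close>)
  moreover have eq: "(\<Pi>\<^sub>M n\<in>S. exp_law (rates b a (prod.swap n))) = exp_prod S (rates a b)"
    unfolding exp_prod_def by (rule PiM_cong) (auto simp: add.commute)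
  moreover have "distr (exp_prod ?S (rates b a)) (exp_prod S (rates a b)) ?\<rho> =
      distr (exp_prod ?S (rates b a)) (\<Pi>\<^sub>M i\<in>S. borel) ?\<rho>"
    by (rule distr_cong) (simp_all add: sets_exp_prod)
  ultimately have law: "exp_prod S (rates a b) = distr (exp_prod ?S (rates b a)) (\<Pi>\<^sub>M i\<in>S. borel) ?\<rho>"
    by argo
  have "lpp_law S (rates a b) J = distr (exp_prod ?S (rates b a)) (\<Pi>\<^sub>M i\<in>J. borel) (?L J \<circ> ?\<rho>)"
    unfolding lpp_law_def joint_law_def law
    using measurable_last_passage_family[OF S(2)] \<rho>
    by (intro distr_distr) (simp_all only: measurable_cong_sets[OF sets_exp_prod refl])
  also have "\<dots> = distr (exp_prod ?S (rates b a)) (\<Pi>\<^sub>M i\<in>J. borel) (?\<Psi> \<circ> ?L ?J)"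
  proof (intro distr_cong refl)
    fix w
    have "(case i of (x, y) \<Rightarrow> last_passage x y) (?\<rho> w) = ?L ?J w (map_prod prod.swap prod.swap i)"
      if "i \<in> J" for i
    proof -
      obtain u v where i: "i = (u, v)" by (cases i)
      have "?L ?J w (map_prod prod.swap prod.swap i) = last_passage (prod.swap u) (prod.swap v) w"
        using imageI[OF that, of "map_prod prod.swap prod.swap"] unfolding i by simp
      then show ?thesis
        using last_passage_restrict[OF S(2) that, of "\<lambda>p. w (prod.swap p)"]
        unfolding last_passage_swap by (simp add: i)
    qed
    then show "(?L J \<circ> ?\<rho>) w = (?\<Psi> \<circ> ?L ?J) w" unfolding comp_def by (rule restrict_ext)
  qed
  also have "\<dots> = distr (lpp_law ?S (rates b a) ?J) (\<Pi>\<^sub>M i\<in>J. borel) ?\<Psi>"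
  proof -
    have "?\<Psi> \<in> measurable (\<Pi>\<^sub>M i\<in>?J. borel) (\<Pi>\<^sub>M i\<in>J. (borel :: real measure))"
      by (intro measurable_restrict measurable_component_singleton) auto
    then show ?thesis
      unfolding lpp_law_def joint_law_def
      using measurable_last_passage_family[OF covers]
      by (intro distr_distr[symmetric]) (simp_all only: measurable_cong_sets[OF sets_exp_prod refl])
  qed
  finally show ?thesis .
qed

text \<open>Both laws are images, under the same renaming, of laws for the reflected rectangles,
  where \<open>\<tau>\<close> acts on columns.\<close>

lemma lpp_law_permute_rows:
  fixes a b :: "int \<Rightarrow> real"
  assumes S: "finite S" "covers S J" and pos: "\<And>i j. 0 < a i + b j" and \<tau>: "\<tau> permutes {lo..hi}"
    and J: "\<And>u v. (u, v) \<in> J \<Longrightarrow> \<tau> ` {..<snd u} = {..<snd u} \<and> \<tau> ` {snd v<..} = {snd v<..}"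
  shows "lpp_law S (rates a b) J = lpp_law S (rates a (b \<circ> \<tau>)) J"
proof -
  let ?S = "prod.swap ` S" and ?J = "map_prod prod.swap prod.swap ` J"
  have "\<tau> ` {..<fst u} = {..<fst u} \<and> \<tau> ` {fst v<..} = {fst v<..}" if uv: "(u, v) \<in> ?J" for u v
  proof -
    from uv obtain u' v' where "(u', v') \<in> J" "u = prod.swap u'" "v = prod.swap v'" by force
    then show ?thesis using J by simp
  qed
  moreover have "0 < b i + a j" for i j using pos[of j i] by (simp add: add.commute)
  ultimately have "lpp_law ?S (rates b a) ?J = lpp_law ?S (rates (b \<circ> \<tau>) a) ?J"
    using S(1) covers_swap[OF S(2)] \<tau> by (intro lpp_law_permute_columns) auto
  then show ?thesis
    using lpp_law_swap[OF S, of a b] lpp_law_swap[OF S, of a "b \<circ> \<tau>"] pos by simp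
qed

section \<open>From finite families to the whole process\<close>

lemma finite_perm_permutes:
  assumes "finite_perm \<sigma>"
  obtains lo hi where "\<sigma> permutes {lo..hi}"
proof -
  define F where "F = {i. \<sigma> i \<noteq> i}"
  have F: "finite F" "bij \<sigma>" using assms by (auto simp: finite_perm_def F_def)
  \<comment> \<open>If \<open>F\<close> is empty the endpoints are unspecified, but then
    \<open>\<sigma>\<close> is the identity and permutes any interval.\<close>
  then have "F \<subseteq> {Min F..Max F}" by auto
  then have "\<sigma> i = i" if "i \<notin> {Min F..Max F}" for i using that unfolding F_def by blast
  moreover have "\<exists>!i. \<sigma> i = j" for j using F(2) by (simp add: bij_iff)
  ultimately have "\<sigma> permutes {Min F..Max F}" unfolding permutes_def by blast
  then show thesis by (rule that)
qed

text \<open>A cylinder set constrains only the coordinates in \<open>J\<close>, so its measure is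
  read off from the marginal law on \<open>J\<close>.\<close>

lemma emeasure_joint_law_prod_emb:
  assumes X: "\<And>i. i \<in> I \<Longrightarrow> X i \<in> borel_measurable M" and J: "J \<subseteq> I" "finite J"
    and A: "\<And>i. i \<in> J \<Longrightarrow> A i \<in> sets borel"
  shows "emeasure (joint_law M I X) (prod_emb I (\<lambda>_. borel) J (Pi\<^sub>E J A)) =
    emeasure (joint_law M J X) (Pi\<^sub>E J A)"
proof -
  have "distr (joint_law M I X) (\<Pi>\<^sub>M i\<in>J. borel) (\<lambda>g. restrict g J) =
      distr M (\<Pi>\<^sub>M i\<in>J. borel) ((\<lambda>g. restrict g J) \<circ> (\<lambda>s. \<lambda>i\<in>I. X i s))"
    unfolding joint_law_def
    by (intro distr_distr measurable_restrict_subset J(1) measurable_restrict X)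
  also have "(\<lambda>g. restrict g J) \<circ> (\<lambda>s. \<lambda>i\<in>I. X i s) = (\<lambda>s. \<lambda>i\<in>J. X i s)"
    using J(1) by (auto simp: fun_eq_iff restrict_def)
  finally have "joint_law M J X = distr (joint_law M I X) (\<Pi>\<^sub>M i\<in>J. borel) (\<lambda>g. restrict g J)"
    by (simp only: joint_law_def)
  then show ?thesis
    using emeasure_distr_restrict[OF J(1), of "joint_law M I X" "\<lambda>_. borel" "Pi\<^sub>E J A"] J A
    by (simp add: joint_law_def sets_PiM_I_finite)
qed

theorem theorem3p1:
  fixes a b :: "int \<Rightarrow> real" and \<sigma> \<tau> :: "int \<Rightarrow> int"
    and M :: "'s measure" and N :: "'t measure"
    and \<omega> :: "int \<times> int \<Rightarrow> 's \<Rightarrow> real" and \<omega>' :: "int \<times> int \<Rightarrow> 't \<Rightarrow> real"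
  assumes "\<And>i j. a i + b j > 0"
    and "finite_perm \<sigma>" and "finite_perm \<tau>"
    and "exp_weights M a b \<omega>"
    and "exp_weights N (a \<circ> \<sigma>) (b \<circ> \<tau>) \<omega>'"
  shows "joint_law M (perm_pairs \<sigma> \<tau>) (\<lambda>(x, y) s. last_passage x y (\<lambda>p. \<omega> p s)) =
         joint_law N (perm_pairs \<sigma> \<tau>) (\<lambda>(x, y) s. last_passage x y (\<lambda>p. \<omega>' p s))"
proof (rule measure_eqI_PiM_infinite)
  let ?I = "perm_pairs \<sigma> \<tau>"
  let ?X = "\<lambda>(x, y) s. last_passage x y (\<lambda>p. \<omega> p s)" and ?Y = "\<lambda>(x, y) s. last_passage x y (\<lambda>p. \<omega>' p s)"
  interpret M: prob_space M using assms(4) by (simp add: exp_weights_def)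
  interpret N: prob_space N using assms(5) by (simp add: exp_weights_def)
  show "sets (joint_law M ?I ?X) = sets (\<Pi>\<^sub>M i\<in>?I. borel)"
    "sets (joint_law N ?I ?Y) = sets (\<Pi>\<^sub>M i\<in>?I. borel)"
    by (simp_all add: joint_law_def)
  have rv: "\<omega> p \<in> borel_measurable M" "\<omega>' p \<in> borel_measurable N" for p
    using assms(4,5) unfolding exp_weights_def M.indep_vars_def N.indep_vars_def by blast+
  have X: "?X i \<in> borel_measurable M" "?Y i \<in> borel_measurable N" if "i \<in> ?I" for i
    using that rv by (auto simp: perm_pairs_def intro!: measurable_last_passage)
  show "finite_measure (joint_law M ?I ?X)"
    unfolding joint_law_def
    by (intro prob_space.finite_measure M.prob_space_distr measurable_restrict X)
  \<comment> \<open>Finite measures on the product are determined by their values on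
    finite-dimensional cylinders, so a finite subfamily \<open>J\<close> is enough.\<close>
  fix A :: "(int \<times> int) \<times> (int \<times> int) \<Rightarrow> real set" and J
  assume J: "finite J" "J \<subseteq> ?I" and A: "\<And>i. i \<in> J \<Longrightarrow> A i \<in> sets borel"
  \<comment> \<open>The origin keeps \<open>S\<close> nonempty when \<open>J\<close> is empty, as
    \<open>joint_law_exp_weights\<close> requires.\<close>
  define S where "S = insert (0, 0) (\<Union>(u, v)\<in>J. {fst u..fst v} \<times> {snd u..snd v})"
  have pairs: "fst u \<le> fst v" "snd u \<le> snd v"
    "\<sigma> ` {..<fst u} = {..<fst u} \<and> \<sigma> ` {fst v<..} = {fst v<..}"
    "\<tau> ` {..<snd u} = {..<snd u} \<and> \<tau> ` {snd v<..} = {snd v<..}" if "(u, v) \<in> J" for u v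
  proof -
    have "(u, v) \<in> ?I" using J(2) that by blast
    then show "fst u \<le> fst v" "snd u \<le> snd v"
      "\<sigma> ` {..<fst u} = {..<fst u} \<and> \<sigma> ` {fst v<..} = {fst v<..}"
      "\<tau> ` {..<snd u} = {..<snd u} \<and> \<tau> ` {snd v<..} = {snd v<..}"
      by (cases u; cases v; simp add: perm_pairs_def)+
  qed
  have S: "finite S" "S \<noteq> {}" "covers S J"
  proof -
    show "finite S" "S \<noteq> {}" using J(1) by (auto simp: S_def)
    have "{fst u..fst v} \<times> {snd u..snd v} \<subseteq> S" if "(u, v) \<in> J" for u v
      unfolding S_def using that by blast
    with pairs(1,2) show "covers S J" unfolding covers_def by blast
  qed
  obtain lo hi where \<sigma>: "\<sigma> permutes {lo..hi}" using finite_perm_permutes[OF assms(2)] .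
  obtain lo' hi' where \<tau>: "\<tau> permutes {lo'..hi'}" using finite_perm_permutes[OF assms(3)] .
  \<comment> \<open>Columns are permuted first. The rates stay positive, so the rows can follow with
    \<open>a \<circ> \<sigma>\<close> in place of \<open>a\<close>.\<close>
  have "lpp_law S (rates a b) J = lpp_law S (rates (a \<circ> \<sigma>) b) J"
    using S(1,3) assms(1) \<sigma> pairs(3) by (rule lpp_law_permute_columns)
  also have "\<dots> = lpp_law S (rates (a \<circ> \<sigma>) (b \<circ> \<tau>)) J"
    by (rule lpp_law_permute_rows[OF S(1,3) _ \<tau> pairs(4)]) (use assms(1) in auto)
  finally have "joint_law M J ?X = joint_law N J ?Y"
    unfolding joint_law_exp_weights[OF assms(4) S] joint_law_exp_weights[OF assms(5) S] .
  then show "emeasure (joint_law M ?I ?X) (prod_emb ?I (\<lambda>_. borel) J (Pi\<^sub>E J A)) =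
      emeasure (joint_law N ?I ?Y) (prod_emb ?I (\<lambda>_. borel) J (Pi\<^sub>E J A))"
    using X J A by (simp only: emeasure_joint_law_prod_emb)
qed

end
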